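(* Let $n\ge2$, let $(S_1,\dots,S_{n-1},P)$ be a $\Gamma_n$-contraction on a Hilbert space $\mathcal H$, and let $$\mathcal E=\{x\in\mathcal H:\langle P^kx,y\rangle\to0\text{ as }k\to\infty\text{ for all }y\in\mathcal H\}.$$ Then: (1) $\mathcal E$ and $\mathcal E^\perp$ reduce $S_1,\dots,S_{n-1}$; (2) $(S_1|_{\mathcal E},\dots,S_{n-1}|_{\mathcal E},P|_{\mathcal E})$ is a weakly stable $\Gamma_n$-contraction; (3) $(S_1|_{\mathcal E^\perp},\dots,S_{n-1}|_{\mathcal E^\perp},P|_{\mathcal E^\perp})$ is a $\Gamma_n$-unitary.
   Context: All operators are bounded linear operators on complex Hilbert spaces. A closed subspace reduces $T$ if it is invariant under $T$ and $T^*$. A compact set $K\subset\mathbb C^n$ is a spectral set for a commuting $n$-tuple $\underline T$ if the Taylor joint spectrum of $\underline T$ lies in $K$ and $\|f(\underline T)\|\le\sup_{K}|f|$ for every rational function $f$ with poles off $K$. The closed symmetrized polydisc is $\Gamma_n=\pi_n(\overline{\mathbb D}^n)$, where $\pi_n(z_1,\dots,z_n)=(\sum_i z_i,\sum_{i<j}z_iz_j,\dots,\prod_i z_i)$, and $b\Gamma_n=\pi_n(\mathbb T^n)$. A $\Gamma_n$-contraction is a commuting $n$-tuple $(S_1,\dots,S_{n-1},P)$ having $\Gamma_n$ as a spectral set (then $P$ is a contraction). A $\Gamma_n$-unitary is a commuting tuple of normal operators with Taylor joint spectrum contained in $b\Gamma_n$. A $\Gamma_n$-contraction $(S_1,\dots,S_{n-1},P)$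 is weakly stable if $\langle P^kx,y\rangle\to0$ as $k\to\infty$ for all $x,y$. Foguel's theorem: for a contraction $P$, the set $\mathcal E$ above is a (closed) subspace reducing $P$, $P|_{\mathcal E}$ is a weakly stable contraction and $P|_{\mathcal E^\perp}$ is unitary. *)

theory Defs
  imports "HOL-Analysis.Analysis" "HOL-Library.Poly_Mapping"
begin

text \<open>The inner product is linear in the first argument. The last axiom says that the
  norm is the one induced by \<open>cinner\<close>; with the norm axioms it makes \<open>cinner\<close> positive definite.\<close>

class complex_hilbert_space = banach +
  fixes scaleC :: "complex \<Rightarrow> 'a \<Rightarrow> 'a"  (infixr \<open>*\<^sub>C\<close> 75)
    and cinner :: "'a \<Rightarrow> 'a \<Rightarrow> complex"
  assumes scaleC_add_right: "c *\<^sub>C (x + y) = c *\<^sub>C x + c *\<^sub>C y"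
    and scaleC_add_left: "(c + d) *\<^sub>C x = c *\<^sub>C x + d *\<^sub>C x"
    and scaleC_scaleC: "c *\<^sub>C (d *\<^sub>C x) = (c * d) *\<^sub>C x"
    and scaleR_scaleC: "r *\<^sub>R x = complex_of_real r *\<^sub>C x"
    and cinner_commute: "cinner x y = cnj (cinner y x)"
    and cinner_add_left: "cinner (x + y) z = cinner x z + cinner y z"
    and cinner_scaleC_left: "cinner (c *\<^sub>C x) y = c * cinner x y"
    and cinner_self: "cinner x x = complex_of_real ((norm x)\<^sup>2)"

instantiation complex :: complex_hilbert_space
begin

definition scaleC_complex :: "complex \<Rightarrow> complex \<Rightarrow> complex" where
  "scaleC_complex c x = c * x"

definition cinner_complex :: "complex \<Rightarrow> complex \<Rightarrow> complex" where
  "cinner_complex x y = x * cnj y"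

instance
proof
  fix c d x y z :: complex and r :: real
  show "c *\<^sub>C (x + y) = c *\<^sub>C x + c *\<^sub>C y"
    by (simp add: scaleC_complex_def distrib_left)
  show "(c + d) *\<^sub>C x = c *\<^sub>C x + d *\<^sub>C x"
    by (simp add: scaleC_complex_def distrib_right)
  show "c *\<^sub>C (d *\<^sub>C x) = (c * d) *\<^sub>C x"
    by (simp add: scaleC_complex_def mult.assoc)
  show "r *\<^sub>R x = complex_of_real r *\<^sub>C x"
    by (simp add: scaleC_complex_def scaleR_conv_of_real)
  show "cinner x y = cnj (cinner y x)"
    by (simp add: cinner_complex_def mult.commute)
  show "cinner (x + y) z = cinner x z + cinner y z"
    by (simp add: cinner_complex_def distrib_right)
  show "cinner (c *\<^sub>C x) y = c * cinner x y"
    by (simp add: scaleC_complex_def cinner_complex_def mult.assoc)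
  show "cinner x x = complex_of_real ((norm x)\<^sup>2)"
    unfolding cinner_complex_def by (rule complex_norm_square [symmetric])
qed

end

definition closed_csubspace :: "'a::complex_hilbert_space set \<Rightarrow> bool" where
  "closed_csubspace M \<longleftrightarrow> closed M \<and> 0 \<in> M \<and> (\<forall>x\<in>M. \<forall>y\<in>M. x + y \<in> M) \<and>
     (\<forall>c. \<forall>x\<in>M. c *\<^sub>C x \<in> M)"

definition orth_complement :: "'a::complex_hilbert_space set \<Rightarrow> 'a set" where
  "orth_complement M = {x. \<forall>y\<in>M. cinner x y = 0}"

text \<open>All operator-theoretic notions below carry the Hilbert space as a closed subspace \<open>M\<close> of
  the ambient type and look at an operator only on \<open>M\<close>. So a notion for \<open>M\<close> and \<open>A\<close> is the
  usual notion for the restriction of \<open>A\<close> to \<open>M\<close>, and \<open>M = UNIV\<close> gives operators on the whole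
  space.\<close>

definition bounded_op_on :: "'a::complex_hilbert_space set \<Rightarrow> ('a \<Rightarrow> 'a) \<Rightarrow> bool" where
  "bounded_op_on M A \<longleftrightarrow> A \<in> M \<rightarrow> M \<and> (\<forall>x\<in>M. \<forall>y\<in>M. A (x + y) = A x + A y) \<and>
     (\<forall>c. \<forall>x\<in>M. A (c *\<^sub>C x) = c *\<^sub>C A x) \<and> (\<exists>B. \<forall>x\<in>M. norm (A x) \<le> B * norm x)"

definition op_norm_on :: "'a::complex_hilbert_space set \<Rightarrow> ('a \<Rightarrow> 'a) \<Rightarrow> ereal" where
  "op_norm_on M A = (SUP x\<in>{x\<in>M. norm x \<le> 1}. ereal (norm (A x)))"

definition adjoint_on :: "'a::complex_hilbert_space set \<Rightarrow> ('a \<Rightarrow> 'a) \<Rightarrow> 'a \<Rightarrow> 'a" where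
  "adjoint_on M A y = (THE z. z \<in> M \<and> (\<forall>x\<in>M. cinner (A x) y = cinner x z))"

definition normal_op_on :: "'a::complex_hilbert_space set \<Rightarrow> ('a \<Rightarrow> 'a) \<Rightarrow> bool" where
  "normal_op_on M A \<longleftrightarrow> bounded_op_on M A \<and>
     (\<forall>x\<in>M. A (adjoint_on M A x) = adjoint_on M A (A x))"

definition reduces :: "'a::complex_hilbert_space set \<Rightarrow> ('a \<Rightarrow> 'a) \<Rightarrow> bool" where
  "reduces M A \<longleftrightarrow> closed_csubspace M \<and> A ` M \<subseteq> M \<and> adjoint_on UNIV A ` M \<subseteq> M"

text \<open>An \<open>n\<close>-tuple of operators is \<open>T 1, \<dots>, T n\<close>; other values of \<open>T\<close> are ignored.\<close>

definition commuting_tuple_on ::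
    "'a::complex_hilbert_space set \<Rightarrow> nat \<Rightarrow> (nat \<Rightarrow> 'a \<Rightarrow> 'a) \<Rightarrow> bool" where
  "commuting_tuple_on M n T \<longleftrightarrow> closed_csubspace M \<and> (\<forall>i\<in>{1..n}. bounded_op_on M (T i)) \<and>
     (\<forall>i\<in>{1..n}. \<forall>j\<in>{1..n}. \<forall>x\<in>M. T i (T j x) = T j (T i x))"

text \<open>The Koszul complex of \<open>A 1, \<dots>, A n\<close> on \<open>M \<otimes> \<Lambda>(\<complex>\<^sup>n)\<close>: an element \<open>\<phi>\<close> is given by
  its coefficients \<open>\<phi> J\<close> at \<open>e\<^sub>J = e\<^bsub>j1\<^esub> \<and> \<dots> \<and> e\<^bsub>jk\<^esub>\<close> for \<open>J = {j1 < \<dots> < jk}\<close>, and the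
  differential is \<open>\<Sum>j. A j \<otimes> (e\<^sub>j \<and> _)\<close>. All degrees are treated at once: the differential
  is homogeneous of degree 1, so exactness of the whole is exactness in every degree.\<close>

definition koszul_space :: "'a::complex_hilbert_space set \<Rightarrow> nat \<Rightarrow> (nat set \<Rightarrow> 'a) set" where
  "koszul_space M n = Pow {1..n} \<rightarrow>\<^sub>E M"

definition koszul_diff ::
    "nat \<Rightarrow> (nat \<Rightarrow> 'a \<Rightarrow> 'a) \<Rightarrow> (nat set \<Rightarrow> 'a::complex_hilbert_space) \<Rightarrow> nat set \<Rightarrow> 'a" where
  "koszul_diff n A \<phi> =
     (\<lambda>J\<in>Pow {1..n}. \<Sum>j\<in>J. (- 1) ^ card {i\<in>J. i < j} *\<^sub>C A j (\<phi> (J - {j})))"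

definition koszul_exact ::
    "'a::complex_hilbert_space set \<Rightarrow> nat \<Rightarrow> (nat \<Rightarrow> 'a \<Rightarrow> 'a) \<Rightarrow> bool" where
  "koszul_exact M n A \<longleftrightarrow>
     {\<phi> \<in> koszul_space M n. \<forall>J\<in>Pow {1..n}. koszul_diff n A \<phi> J = 0} =
     koszul_diff n A ` koszul_space M n"

text \<open>Points of \<open>\<complex>\<^sup>n\<close> are the functions in \<open>extensional {1..n}\<close>. The product topology on
  \<open>nat \<Rightarrow> complex\<close> induces the usual topology there.\<close>

definition taylor_spectrum ::
    "'a::complex_hilbert_space set \<Rightarrow> nat \<Rightarrow> (nat \<Rightarrow> 'a \<Rightarrow> 'a) \<Rightarrow> (nat \<Rightarrow> complex) set" where
  "taylor_spectrum M n T =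
     {\<mu> \<in> extensional {1..n}. \<not> koszul_exact M n (\<lambda>i x. T i x - \<mu> i *\<^sub>C x)}"

text \<open>A monomial \<open>m\<close> maps the index of a variable to its exponent.\<close>

type_synonym cmpoly = "(nat \<Rightarrow>\<^sub>0 nat) \<Rightarrow>\<^sub>0 complex"

definition polys_in :: "nat \<Rightarrow> cmpoly set" where
  "polys_in n = {p. \<forall>m\<in>Poly_Mapping.keys p. Poly_Mapping.keys m \<subseteq> {1..n}}"

definition poly_at :: "nat \<Rightarrow> cmpoly \<Rightarrow> (nat \<Rightarrow> complex) \<Rightarrow> complex" where
  "poly_at n p z = (\<Sum>m\<in>Poly_Mapping.keys p.
     Poly_Mapping.lookup p m * (\<Prod>i\<in>{1..n}. z i ^ Poly_Mapping.lookup m i))"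

definition monomial_op ::
    "nat \<Rightarrow> (nat \<Rightarrow>\<^sub>0 nat) \<Rightarrow> (nat \<Rightarrow> 'a \<Rightarrow> 'a) \<Rightarrow> 'a::complex_hilbert_space \<Rightarrow> 'a" where
  "monomial_op n m T x = foldr (\<lambda>i. T i ^^ Poly_Mapping.lookup m i) [1..<Suc n] x"

definition poly_op ::
    "nat \<Rightarrow> cmpoly \<Rightarrow> (nat \<Rightarrow> 'a \<Rightarrow> 'a) \<Rightarrow> 'a::complex_hilbert_space \<Rightarrow> 'a" where
  "poly_op n p T x =
     (\<Sum>m\<in>Poly_Mapping.keys p. Poly_Mapping.lookup p m *\<^sub>C monomial_op n m T x)"

text \<open>\<open>(p / q)(T) = p(T) q(T)\<^sup>-\<^sup>1\<close>. If the Taylor spectrum of \<open>T\<close> lies in \<open>K\<close> and \<open>q\<close> has no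
  zero in \<open>K\<close>, then \<open>q(T)\<close> is a bijection of \<open>M\<close> by spectral mapping, and \<open>inv_into\<close> is its
  inverse.\<close>

definition rational_op_on :: "'a::complex_hilbert_space set \<Rightarrow> nat \<Rightarrow> cmpoly \<Rightarrow> cmpoly \<Rightarrow>
    (nat \<Rightarrow> 'a \<Rightarrow> 'a) \<Rightarrow> 'a \<Rightarrow> 'a" where
  "rational_op_on M n p q T x = poly_op n p T (inv_into M (poly_op n q T) x)"

text \<open>A rational function has no poles on \<open>K\<close> iff it is \<open>p / q\<close> with \<open>q\<close> zero-free on \<open>K\<close>
  (take the fraction in lowest terms).\<close>

definition spectral_set_on :: "'a::complex_hilbert_space set \<Rightarrow> nat \<Rightarrow> (nat \<Rightarrow> complex) set \<Rightarrow>
    (nat \<Rightarrow> 'a \<Rightarrow> 'a) \<Rightarrow> bool" where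
  "spectral_set_on M n K T \<longleftrightarrow>
     K \<subseteq> extensional {1..n} \<and> compact K \<and> commuting_tuple_on M n T \<and>
     taylor_spectrum M n T \<subseteq> K \<and>
     (\<forall>p\<in>polys_in n. \<forall>q\<in>polys_in n. (\<forall>z\<in>K. poly_at n q z \<noteq> 0) \<longrightarrow>
        op_norm_on M (rational_op_on M n p q T) \<le>
        (SUP z\<in>K. ereal (cmod (poly_at n p z / poly_at n q z))))"

definition sym_map :: "nat \<Rightarrow> (nat \<Rightarrow> complex) \<Rightarrow> nat \<Rightarrow> complex" where
  "sym_map n z = (\<lambda>k\<in>{1..n}. \<Sum>I | I \<subseteq> {1..n} \<and> card I = k. \<Prod>i\<in>I. z i)"

definition sym_polydisc :: "nat \<Rightarrow> (nat \<Rightarrow> complex) set" where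
  "sym_polydisc n = sym_map n ` ({1..n} \<rightarrow>\<^sub>E cball 0 1)"

definition sym_torus :: "nat \<Rightarrow> (nat \<Rightarrow> complex) set" where
  "sym_torus n = sym_map n ` ({1..n} \<rightarrow>\<^sub>E sphere 0 1)"

definition gamma_contraction_on ::
    "'a::complex_hilbert_space set \<Rightarrow> nat \<Rightarrow> (nat \<Rightarrow> 'a \<Rightarrow> 'a) \<Rightarrow> bool" where
  "gamma_contraction_on M n T \<longleftrightarrow> spectral_set_on M n (sym_polydisc n) T"

definition gamma_unitary_on ::
    "'a::complex_hilbert_space set \<Rightarrow> nat \<Rightarrow> (nat \<Rightarrow> 'a \<Rightarrow> 'a) \<Rightarrow> bool" where
  "gamma_unitary_on M n T \<longleftrightarrow> commuting_tuple_on M n T \<and> (\<forall>i\<in>{1..n}. normal_op_on M (T i)) \<and>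
     taylor_spectrum M n T \<subseteq> sym_torus n"

definition weakly_stable_gamma_contraction_on ::
    "'a::complex_hilbert_space set \<Rightarrow> nat \<Rightarrow> (nat \<Rightarrow> 'a \<Rightarrow> 'a) \<Rightarrow> bool" where
  "weakly_stable_gamma_contraction_on M n T \<longleftrightarrow> gamma_contraction_on M n T \<and>
     (\<forall>x\<in>M. \<forall>y\<in>M. (\<lambda>k. cinner ((T n ^^ k) x) y) \<longlonglongrightarrow> 0)"

end

theory Submission
  imports Defs "HOL-Complex_Analysis.Conformal_Mappings"
begin

text \<open>
  Write \<open>P\<close> for the last operator \<open>T\<^sub>n\<close> and \<open>s\<^sub>1, \<dots>, s\<^sub>n\<^sub>-\<^sub>1, p\<close> for the coordinates of
  \<open>\<complex>\<^sup>n\<close>.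

  A contraction \<open>P\<close> is asymptotically isometric along its orbits: \<open>(1 - P\<^sup>* P) P\<^sup>k x \<rightarrow> 0\<close>
  because the norms \<open>\<parallel>P\<^sup>k x\<parallel>\<close> decrease. Hence \<open>P\<^sup>k x\<close> tends weakly to zero if and only if
  \<open>P\<^sup>*\<^sup>k x\<close> does (\<open>weak_null_set_adjoint\<close>). So \<open>E\<close> is invariant under whatever commutes with
  \<open>P\<close> or with \<open>P\<^sup>*\<close>, in particular under all \<open>T\<^sub>i\<close> and their adjoints. The same asymptotic
  isometry puts the ranges of \<open>1 - P\<^sup>* P\<close> and \<open>1 - P P\<^sup>*\<close> into \<open>E\<close>, and \<open>P\<close> is therefore
  unitary on the complement of \<open>E\<close> (\<open>isometric_off_weak_null_set\<close>).

  A restriction to a reducing subspace inherits the spectral set, once the inverse of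
  \<open>q(T)\<close> is known to restrict as well. For this \<open>q(T)\<close> has to be invertible whenever \<open>q\<close> has no zero
  on the symmetrized polydisc (\<open>poly_op_bij\<close>). Instead of a spectral mapping theorem the proof uses
  that the symmetrized polydisc is closed under the dilations \<open>(t s\<^sub>1, t\<^sup>2 s\<^sub>2, \<dots>, t\<^sup>n p)\<close>, which
  come from \<open>z \<mapsto> t z\<close> on the polydisc. They deform \<open>q\<close> into a nonzero constant, and the spectral set
  inequality bounds the inverses along the deformation uniformly.

  On the complement of \<open>E\<close>, where \<open>P\<close> is unitary, the adjoint of \<open>T\<^sub>i\<close> is \<open>T\<^sub>n\<^sub>-\<^sub>i P\<^sup>*\<close>
  (\<open>adjoint_eq_on_unitary_part\<close>). This mirrors the identity \<open>cnj s\<^sub>i = s\<^sub>n\<^sub>-\<^sub>i / p\<close> on the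
  distinguished boundary, where polynomials attain their maximum: the real functions \<open>2 Re s\<^sub>i\<close> and
  \<open>2 Im s\<^sub>i\<close> correspond to operators \<open>A\<close> with \<open>\<parallel>A + \<i> t\<parallel>\<^sup>2 \<le> C + t\<^sup>2\<close> for all real
  \<open>t\<close>, and such operators are self-adjoint. So the \<open>T\<^sub>i\<close> are normal there. A point of the Taylor
  spectrum has a last coordinate of modulus one, since \<open>P - \<mu>\<^sub>n\<close> is invertible otherwise
  (\<open>koszul_exact_if_last_invertible\<close>), and the points of the symmetrized polydisc with this property are
  those of the distinguished boundary.
\<close>

section \<open>Geometry of complex Hilbert spaces\<close>

lemma scaleC_one [simp]: "1 *\<^sub>C (x::'a::complex_hilbert_space) = x"
  using scaleR_scaleC[of 1 x] by simp

lemma scaleC_zero_left [simp]: "0 *\<^sub>C (x::'a::complex_hilbert_space) = 0"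
  using scaleR_scaleC[of 0 x] by simp

lemma scaleC_zero_right [simp]: "c *\<^sub>C (0::'a::complex_hilbert_space) = 0"
  using scaleC_add_right[of c 0 "0::'a"] by simp

lemma scaleC_minus_one [simp]: "(-1) *\<^sub>C (x::'a::complex_hilbert_space) = - x"
  using scaleR_scaleC[of "-1" x] by simp

lemma scaleC_minus_left: "(- c) *\<^sub>C (x::'a::complex_hilbert_space) = - (c *\<^sub>C x)"
  using scaleC_add_left[of c "-c" x] by (simp add: eq_neg_iff_add_eq_0 add.commute)

lemma scaleC_minus_right: "c *\<^sub>C (- x::'a::complex_hilbert_space) = - (c *\<^sub>C x)"
  using scaleC_add_right[of c x "-x"] by (simp add: eq_neg_iff_add_eq_0 add.commute)

lemma scaleC_diff_right: "c *\<^sub>C (x - y::'a::complex_hilbert_space) = c *\<^sub>C x - c *\<^sub>C y"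
  using scaleC_add_right[of c x "-y"] by (simp add: scaleC_minus_right)

lemma scaleC_diff_left: "(c - d) *\<^sub>C (x::'a::complex_hilbert_space) = c *\<^sub>C x - d *\<^sub>C x"
  using scaleC_add_left[of c "-d" x] by (simp add: scaleC_minus_left)

lemma scaleC_sum_right: "c *\<^sub>C (\<Sum>i\<in>I. f i) = (\<Sum>i\<in>I. c *\<^sub>C (f i::'a::complex_hilbert_space))"
  by (induction I rule: infinite_finite_induct) (auto simp: scaleC_add_right)

lemma cinner_add_right: "cinner x (y + z) = cinner x y + cinner x z"
  by (metis cinner_add_left cinner_commute complex_cnj_add)

lemma cinner_scaleC_right: "cinner x (c *\<^sub>C y) = cnj c * cinner x y"
  by (metis cinner_commute cinner_scaleC_left complex_cnj_mult)

lemma cinner_zero_left [simp]: "cinner 0 y = 0"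
  using cinner_scaleC_left[of 0 0 y] by simp

lemma cinner_zero_right [simp]: "cinner y 0 = 0"
  using cinner_scaleC_right[of y 0 0] by simp

lemma cinner_minus_left: "cinner (- x) y = - cinner x y"
  using cinner_scaleC_left[of "-1" x y] by simp

lemma cinner_minus_right: "cinner x (- y) = - cinner x y"
  using cinner_scaleC_right[of x "-1" y] by simp

lemma cinner_diff_left: "cinner (x - y) z = cinner x z - cinner y z"
  using cinner_add_left[of x "-y" z] by (simp add: cinner_minus_left)

lemma cinner_diff_right: "cinner x (y - z) = cinner x y - cinner x z"
  using cinner_add_right[of x y "-z"] by (simp add: cinner_minus_right)

lemmas cinner_linear = cinner_add_left cinner_add_right cinner_diff_left cinner_diff_right
  cinner_scaleC_left cinner_scaleC_right

lemma norm_power2_cinner: "(norm x)\<^sup>2 = Re (cinner x x)"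
  by (simp add: cinner_self)

lemma cinner_self_eq_0_iff [simp]: "cinner x x = 0 \<longleftrightarrow> x = 0"
  by (simp add: cinner_self)

lemma norm_scaleC: "norm (c *\<^sub>C x) = cmod c * norm (x::'a::complex_hilbert_space)"
proof -
  have "complex_of_real ((norm (c *\<^sub>C x))\<^sup>2) = (c * cnj c) * cinner x x"
    by (simp only: cinner_self [symmetric] cinner_scaleC_left cinner_scaleC_right mult_ac)
  also have "\<dots> = complex_of_real ((cmod c * norm x)\<^sup>2)"
    by (simp only: cinner_self complex_norm_square [symmetric] of_real_mult power_mult_distrib
        of_real_power)
  finally have "(norm (c *\<^sub>C x))\<^sup>2 = (cmod c * norm x)\<^sup>2"
    using of_real_eq_iff by blast
  then show ?thesis
    by (simp add: power2_eq_iff_nonneg)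
qed

lemma Re_cinner_commute: "Re (cinner y x) = Re (cinner x y)"
  using cinner_commute[of y x] by simp

lemma norm_add_power2: "(norm (x + y))\<^sup>2 = (norm x)\<^sup>2 + 2 * Re (cinner x y) + (norm y)\<^sup>2"
  for x y :: "'a::complex_hilbert_space"
  using Re_cinner_commute[of x y] by (simp add: norm_power2_cinner cinner_linear)

lemma norm_diff_power2: "(norm (x - y))\<^sup>2 = (norm x)\<^sup>2 - 2 * Re (cinner x y) + (norm y)\<^sup>2"
  for x y :: "'a::complex_hilbert_space"
  using Re_cinner_commute[of x y] by (simp add: norm_power2_cinner cinner_linear)

lemma cauchy_schwarz: "cmod (cinner x y) \<le> norm x * norm y"
proof (cases "y = 0")
  case False
  define a where "a = cinner x y"
  define c where "c = a / complex_of_real ((norm y)\<^sup>2)"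
  have ny: "(norm y)\<^sup>2 > 0" using False by simp
  have c: "cinner x (c *\<^sub>C y) = complex_of_real ((cmod a)\<^sup>2 / (norm y)\<^sup>2)"
    unfolding cinner_scaleC_right c_def a_def [symmetric]
    by (simp add: complex_norm_square mult.commute del: of_real_power)
  have "0 \<le> (norm (x - c *\<^sub>C y))\<^sup>2" by simp
  also have "\<dots> = (norm x)\<^sup>2 - 2 * ((cmod a)\<^sup>2 / (norm y)\<^sup>2) + (cmod c * norm y)\<^sup>2"
    unfolding norm_diff_power2 c norm_scaleC by simp
  also have "(cmod c * norm y)\<^sup>2 = (cmod a)\<^sup>2 / (norm y)\<^sup>2"
    using ny by (simp add: c_def norm_divide norm_mult divide_simps power2_eq_square)
  finally have "(cmod a)\<^sup>2 / (norm y)\<^sup>2 \<le> (norm x)\<^sup>2" by simp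
  then have "(cmod a)\<^sup>2 \<le> (norm x * norm y)\<^sup>2"
    using ny by (simp add: divide_le_eq power_mult_distrib)
  then show ?thesis
    unfolding a_def by (rule power2_le_imp_le) simp
qed simp

lemma parallelogram: "(norm (x + y))\<^sup>2 + (norm (x - y))\<^sup>2 = 2 * (norm x)\<^sup>2 + 2 * (norm y)\<^sup>2"
  for x y :: "'a::complex_hilbert_space"
  by (simp add: norm_add_power2 norm_diff_power2)

lemma
  assumes "closed_csubspace M"
  shows csubspace_zero: "0 \<in> M"
    and csubspace_add: "x \<in> M \<Longrightarrow> y \<in> M \<Longrightarrow> x + y \<in> M"
    and csubspace_scaleC: "x \<in> M \<Longrightarrow> c *\<^sub>C x \<in> M"
    and csubspace_diff: "x \<in> M \<Longrightarrow> y \<in> M \<Longrightarrow> x - y \<in> M"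
    and csubspace_closed: "closed M"
proof -
  show "x - y \<in> M" if "x \<in> M" "y \<in> M" for x y
  proof -
    have "x + (-1) *\<^sub>C y \<in> M" using assms that unfolding closed_csubspace_def by blast
    then show ?thesis by simp
  qed
qed (use assms in \<open>auto simp: closed_csubspace_def\<close>)

lemma csubspace_sum: "closed_csubspace M \<Longrightarrow> (\<And>i. i \<in> I \<Longrightarrow> f i \<in> M) \<Longrightarrow> (\<Sum>i\<in>I. f i) \<in> M"
  by (induction I rule: infinite_finite_induct) (auto intro: csubspace_zero csubspace_add)

lemma closed_csubspace_UNIV: "closed_csubspace UNIV"
  by (simp add: closed_csubspace_def)

lemma orth_complement_Int: "x \<in> M \<Longrightarrow> x \<in> orth_complement M \<Longrightarrow> x = 0"
  by (auto simp: orth_complement_def)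

lemma orth_complement_sym: "x \<in> orth_complement M \<Longrightarrow> y \<in> M \<Longrightarrow> cinner y x = 0"
  using cinner_commute[of y x] by (auto simp: orth_complement_def)

text \<open>The functionals form an equicontinuous family, so a limit along the family is stable
  under limits of the argument.\<close>

lemma closed_null_set_equicontinuous:
  fixes c :: "nat \<Rightarrow> 'a::metric_space \<Rightarrow> complex"
  assumes lip: "\<And>k y z. cmod (c k y - c k z) \<le> C * dist y z"
  shows "closed {y. (\<lambda>k. c k y) \<longlonglongrightarrow> 0}"
proof (subst closed_sequential_limits, intro allI impI, elim conjE)
  fix f l
  assume f: "\<forall>n. f n \<in> {y. (\<lambda>k. c k y) \<longlonglongrightarrow> 0}" and l: "f \<longlonglongrightarrow> l"
  show "l \<in> {y. (\<lambda>k. c k y) \<longlonglongrightarrow> 0}"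
  proof (simp, rule LIMSEQ_I)
    fix e :: real assume e: "e > 0"
    have e': "e / (2 * (\<bar>C\<bar> + 1)) > 0" using e by simp
    obtain m where m: "dist (f m) l < e / (2 * (\<bar>C\<bar> + 1))"
      using l e' unfolding lim_sequentially by blast
    obtain N where N: "\<And>k. k \<ge> N \<Longrightarrow> cmod (c k (f m)) < e / 2"
      using LIMSEQ_D[of "\<lambda>k. c k (f m)" 0 "e/2"] f e by auto
    have "cmod (c k l) < e" if "k \<ge> N" for k
    proof -
      have "cmod (c k l - c k (f m)) \<le> (\<bar>C\<bar> + 1) * dist l (f m)"
        by (rule order_trans[OF lip]) (simp add: mult_right_mono)
      also have "\<dots> \<le> (\<bar>C\<bar> + 1) * (e / (2 * (\<bar>C\<bar> + 1)))"
        using m by (intro mult_left_mono) (auto simp: dist_commute)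
      also have "\<dots> = e / 2" by (simp add: field_simps)
      finally show ?thesis
        using N[OF that] norm_triangle_sub[of "c k l" "c k (f m)"] by linarith
    qed
    then show "\<exists>N. \<forall>k\<ge>N. norm (c k l - 0) < e" by auto
  qed
qed

lemma closed_csubspace_orth_complement:
  fixes M :: "'a::complex_hilbert_space set"
  shows "closed_csubspace (orth_complement M)"
proof -
  have *: "closed {x::'a. cinner x y = 0}" for y
  proof -
    have "closed {x::'a. (\<lambda>k::nat. cinner x y) \<longlonglongrightarrow> 0}"
      by (rule closed_null_set_equicontinuous[where C = "norm y"])
        (metis cauchy_schwarz cinner_diff_left dist_norm mult.commute)
    then show ?thesis by (simp add: LIMSEQ_const_iff)
  qed
  have "orth_complement M = (\<Inter>y\<in>M. {x. cinner x y = 0})"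
    by (auto simp: orth_complement_def)
  then have "closed (orth_complement M)" using * by auto
  then show ?thesis
    by (auto simp: closed_csubspace_def orth_complement_def cinner_linear)
qed

text \<open>A minimizing sequence for the distance from \<open>x\<close> to \<open>M\<close> is Cauchy by the parallelogram
  law, and the difference between \<open>x\<close> and the nearest point is orthogonal to \<open>M\<close> because the
  distance cannot be decreased along any line in \<open>M\<close>.\<close>

theorem orthogonal_decomposition:
  fixes x :: "'a::complex_hilbert_space"
  assumes M: "closed_csubspace M"
  obtains u v where "u \<in> M" "v \<in> orth_complement M" "x = u + v"
proof -
  define d where "d = Inf ((\<lambda>u. norm (x - u)) ` M)"
  have bdd: "bdd_below ((\<lambda>u. norm (x - u)) ` M)" by (rule bdd_belowI[where m = 0]) auto
  have d_le: "d \<le> norm (x - u)" if "u \<in> M" for u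
    unfolding d_def using that bdd by (auto intro: cINF_lower)
  have d0: "d \<ge> 0" unfolding d_def using csubspace_zero[OF M] by (auto intro: cINF_greatest)
  have "\<exists>u\<in>M. norm (x - u) < d + inverse (real (Suc k))" for k
    using cINF_less_iff[OF _ bdd, of "d + inverse (real (Suc k))"] csubspace_zero[OF M]
    by (metis d_def empty_iff inverse_positive_iff_positive less_add_same_cancel1
        of_nat_0_less_iff zero_less_Suc)
  then obtain u where uM: "\<And>k. u k \<in> M"
    and ud: "\<And>k. norm (x - u k) < d + inverse (real (Suc k))" by metis
  have lim: "(\<lambda>k. norm (x - u k)) \<longlonglongrightarrow> d"
  proof (rule tendsto_sandwich[of "\<lambda>_. d"])
    show "(\<lambda>k. d + inverse (real (Suc k))) \<longlonglongrightarrow> d"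
      using tendsto_add[OF tendsto_const[of d] LIMSEQ_inverse_real_of_nat] by simp
  qed (use d_le uM ud in \<open>auto simp: less_imp_le\<close>)
  have mid: "(norm (u k - u l))\<^sup>2 \<le> 2 * (norm (x - u k))\<^sup>2 + 2 * (norm (x - u l))\<^sup>2 - 4 * d\<^sup>2" for k l
  proof -
    \<comment> \<open>The midpoint lies in \<open>M\<close>, so it is at distance at least \<open>d\<close> from \<open>x\<close>.\<close>
    have "(1/2) *\<^sub>C (u k + u l) \<in> M" by (intro csubspace_scaleC csubspace_add M uM)
    then have "d \<le> norm (x - (1/2) *\<^sub>C (u k + u l))" by (rule d_le)
    moreover have "2 *\<^sub>R (x - (1/2) *\<^sub>C (u k + u l)) = (x - u k) + (x - u l)"
      by (simp add: scaleR_scaleC scaleC_diff_right scaleC_scaleC scaleR_2 [symmetric])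
    ultimately have "2 * d \<le> norm ((x - u k) + (x - u l))"
      by (metis norm_scaleR abs_numeral mult_le_cancel_left_pos zero_less_numeral)
    then have "(2 * d)\<^sup>2 \<le> (norm ((x - u k) + (x - u l)))\<^sup>2" using d0 by (intro power_mono) auto
    moreover have "norm ((x - u k) - (x - u l)) = norm (u k - u l)"
      by (simp add: norm_minus_commute)
    ultimately show ?thesis
      using parallelogram[of "x - u k" "x - u l"] by (simp add: power_mult_distrib)
  qed
  have "Cauchy u"
  proof (rule metric_CauchyI)
    fix e :: real assume e: "e > 0"
    have "(\<lambda>k. (norm (x - u k))\<^sup>2) \<longlonglongrightarrow> d\<^sup>2" by (intro tendsto_intros lim)
    then obtain N where N: "\<And>k. k \<ge> N \<Longrightarrow> \<bar>(norm (x - u k))\<^sup>2 - d\<^sup>2\<bar> < e\<^sup>2 / 4"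
      using LIMSEQ_D[of "\<lambda>k. (norm (x - u k))\<^sup>2" "d\<^sup>2" "e\<^sup>2 / 4"] e by auto
    have "dist (u k) (u l) < e" if "k \<ge> N" "l \<ge> N" for k l
    proof -
      have "(norm (u k - u l))\<^sup>2 < e\<^sup>2" using mid[of k l] N[OF that(1)] N[OF that(2)] by linarith
      then show ?thesis using e by (simp add: dist_norm power2_less_imp_less)
    qed
    then show "\<exists>N. \<forall>k\<ge>N. \<forall>l\<ge>N. dist (u k) (u l) < e" by blast
  qed
  then obtain p where p: "u \<longlonglongrightarrow> p" by (auto simp: Cauchy_convergent_iff convergent_def)
  have pM: "p \<in> M" using csubspace_closed[OF M] p uM closed_sequentially by blast
  have "(\<lambda>k. norm (x - u k)) \<longlonglongrightarrow> norm (x - p)" by (intro tendsto_intros p)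
  then have dp: "norm (x - p) = d" using lim LIMSEQ_unique by blast
  define v where "v = x - p"
  have "cinner v m = 0" if m: "m \<in> M" for m
  proof (cases "m = 0")
    case False
    define a where "a = cinner v m"
    \<comment> \<open>\<open>c m\<close> is the projection of \<open>v\<close> to the line through \<open>m\<close>.\<close>
    define c where "c = a / complex_of_real ((norm m)\<^sup>2)"
    have ny: "(norm m)\<^sup>2 > 0" using False by simp
    have c: "cinner v (c *\<^sub>C m) = complex_of_real ((cmod a)\<^sup>2 / (norm m)\<^sup>2)"
      unfolding cinner_scaleC_right c_def a_def [symmetric]
      by (simp add: complex_norm_square mult.commute del: of_real_power)
    have "d \<le> norm (x - (p + c *\<^sub>C m))" by (intro d_le csubspace_add csubspace_scaleC M pM m)
    then have "d\<^sup>2 \<le> (norm (v - c *\<^sub>C m))\<^sup>2"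
      unfolding v_def using d0 by (intro power_mono) (auto simp: algebra_simps)
    also have "\<dots> = d\<^sup>2 - 2 * ((cmod a)\<^sup>2 / (norm m)\<^sup>2) + (cmod c * norm m)\<^sup>2"
      unfolding norm_diff_power2 c norm_scaleC using dp by (simp add: v_def)
    also have "(cmod c * norm m)\<^sup>2 = (cmod a)\<^sup>2 / (norm m)\<^sup>2"
      using ny by (simp add: c_def norm_divide norm_mult divide_simps power2_eq_square)
    finally have "(cmod a)\<^sup>2 / (norm m)\<^sup>2 \<le> 0" by simp
    then have "a = 0" using ny by (simp add: divide_le_0_iff)
    then show ?thesis by (simp add: a_def)
  qed simp
  then have "v \<in> orth_complement M" by (simp add: orth_complement_def)
  then show thesis using that[OF pM] by (simp add: v_def)
qed

section \<open>Bounded operators and adjoints\<close>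

lemma
  assumes "bounded_op_on UNIV A"
  shows op_add: "A (x + y) = A x + A y"
    and op_scaleC: "A (c *\<^sub>C x) = c *\<^sub>C A x"
    and op_zero: "A 0 = 0"
    and op_diff: "A (x - y) = A x - A y"
proof -
  show add: "A (x + y) = A x + A y" and sc: "A (c *\<^sub>C x) = c *\<^sub>C A x" for x y c
    using assms by (auto simp: bounded_op_on_def)
  show "A 0 = 0" using sc[of 0 0] by simp
  show "A (x - y) = A x - A y" using add[of x "(-1) *\<^sub>C y"] sc[of "-1" y] by simp
qed

lemma op_sum: "bounded_op_on UNIV A \<Longrightarrow> A (\<Sum>i\<in>I. f i) = (\<Sum>i\<in>I. A (f i))"
  by (induction I rule: infinite_finite_induct) (auto simp: op_zero op_add)

lemma bounded_op_bound:
  assumes "bounded_op_on UNIV A"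
  obtains B where "B \<ge> 0" "\<And>x. norm (A x) \<le> B * norm x"
proof -
  obtain B where "\<And>x. norm (A x) \<le> B * norm x" using assms by (auto simp: bounded_op_on_def)
  then have "norm (A x) \<le> max B 0 * norm x" for x
    by (meson max.cobounded1 mult_right_mono norm_ge_zero order_trans)
  then show thesis by (intro that[of "max B 0"]) auto
qed

text \<open>The representing vector is a multiple of a vector orthogonal to the kernel, which has
  codimension at most one.\<close>

theorem riesz_representation:
  fixes f :: "'a::complex_hilbert_space \<Rightarrow> complex"
  assumes add: "\<And>x y. f (x + y) = f x + f y" and scale: "\<And>c x. f (c *\<^sub>C x) = c * f x"
    and bound: "\<And>x. cmod (f x) \<le> B * norm x"
  obtains z where "\<And>x. f x = cinner x z"
proof -
  have diff: "f (x - y) = f x - f y" for x y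
    using add[of x "(-1) *\<^sub>C y"] scale[of "-1" y] by simp
  define N where "N = {x. f x = 0}"
  have "closed {x. (\<lambda>k::nat. f x) \<longlonglongrightarrow> 0}"
    by (rule closed_null_set_equicontinuous[where C = B])
      (metis bound diff dist_norm)
  then have "closed N" by (simp add: LIMSEQ_const_iff N_def)
  moreover have "f 0 = 0" using scale[of 0 0] by simp
  ultimately have N: "closed_csubspace N"
    by (auto simp: closed_csubspace_def N_def add scale)
  show thesis
  proof (cases "\<forall>x. f x = 0")
    case True
    then show thesis by (intro that[of 0]) simp
  next
    case False
    then obtain x0 where x0: "f x0 \<noteq> 0" by blast
    obtain u v where uv: "u \<in> N" "v \<in> orth_complement N" "x0 = u + v"
      using orthogonal_decomposition[OF N] by blast
    have fv: "f v \<noteq> 0" using x0 uv by (simp add: add N_def)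
    then have v0: "v \<noteq> 0" using \<open>f 0 = 0\<close> by auto
    define z where "z = (cnj (f v) / cinner v v) *\<^sub>C v"
    have "f x = cinner x z" for x
    proof -
      have "f (x - (f x / f v) *\<^sub>C v) = 0" using fv by (simp add: diff scale)
      then have "cinner (x - (f x / f v) *\<^sub>C v) v = 0"
        using orth_complement_sym[OF uv(2)] by (simp add: N_def)
      then have "cinner x v = (f x / f v) * cinner v v" by (simp add: cinner_linear)
      moreover have "cnj (cinner v v) = cinner v v" by (simp add: cinner_self)
      ultimately show ?thesis using v0 fv by (simp add: z_def cinner_linear)
    qed
    then show thesis by (rule that)
  qed
qed

lemma cinner_eq_imp_eq: "(\<And>x. cinner x y = cinner x z) \<Longrightarrow> y = z"
  using cinner_self_eq_0_iff[of "y - z"] by (simp add: cinner_diff_right)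

lemma cinner_eq_imp_eq_left: "(\<And>y. cinner x y = cinner z y) \<Longrightarrow> x = z"
  using cinner_self_eq_0_iff[of "x - z"] by (simp add: cinner_diff_left)

lemma adjoint_on_eqI:
  assumes "closed_csubspace M" "z \<in> M" "\<And>x. x \<in> M \<Longrightarrow> cinner (A x) y = cinner x z"
  shows "adjoint_on M A y = z"
  unfolding adjoint_on_def
proof (rule the_equality)
  show "z \<in> M \<and> (\<forall>x\<in>M. cinner (A x) y = cinner x z)" using assms by blast
next
  fix w assume w: "w \<in> M \<and> (\<forall>x\<in>M. cinner (A x) y = cinner x w)"
  then have wz: "w - z \<in> M" using assms(1,2) by (intro csubspace_diff) auto
  have "cinner (w - z) (w - z) = 0"
    using w assms(3)[OF wz] wz by (simp add: cinner_diff_right)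
  then show "w = z" by simp
qed

text \<open>A relation instead of a function, so that the two operators enter symmetrically and
  statements about one of them transfer to the other.\<close>

definition adjoint_pair :: "('a::complex_hilbert_space \<Rightarrow> 'a) \<Rightarrow> ('a \<Rightarrow> 'a) \<Rightarrow> bool" where
  "adjoint_pair A B \<longleftrightarrow> (\<forall>x y. cinner (A x) y = cinner x (B y))"

lemma adjoint_pairD: "adjoint_pair A B \<Longrightarrow> cinner (A x) y = cinner x (B y)"
  by (simp add: adjoint_pair_def)

lemma adjoint_pair_sym: "adjoint_pair A B \<Longrightarrow> adjoint_pair B A"
  unfolding adjoint_pair_def by (metis cinner_commute)

lemma adjoint_pair_funpow: "adjoint_pair A B \<Longrightarrow> adjoint_pair (A ^^ k) (B ^^ k)"
  by (induction k) (simp_all add: adjoint_pair_def funpow_swap1)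

lemma adjoint_pair_adjoint:
  assumes A: "bounded_op_on UNIV A"
  shows "adjoint_pair A (adjoint_on UNIV A)"
  unfolding adjoint_pair_def
proof (intro allI)
  fix x y
  obtain B where B: "B \<ge> 0" "\<And>x. norm (A x) \<le> B * norm x" using bounded_op_bound[OF A] by blast
  have "cmod (cinner (A x) y) \<le> (B * norm y) * norm x" for x
    using order_trans[OF cauchy_schwarz[of "A x" y] mult_right_mono[OF B(2)[of x], of "norm y"]]
    by (simp add: mult_ac)
  then obtain z where z: "\<And>x. cinner (A x) y = cinner x z"
    using riesz_representation[of "\<lambda>x. cinner (A x) y" "B * norm y"] A
    by (auto simp: op_add op_scaleC cinner_linear)
  then have "adjoint_on UNIV A y = z" by (intro adjoint_on_eqI closed_csubspace_UNIV) auto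
  then show "cinner (A x) y = cinner x (adjoint_on UNIV A y)" by (simp add: z)
qed

lemma adjoint_pair_commute:
  assumes "adjoint_pair A B" "adjoint_pair C D" "\<And>x. A (C x) = C (A x)"
  shows "B (D x) = D (B x)"
  by (rule cinner_eq_imp_eq) (simp add: assms(3) flip: adjoint_pairD[OF assms(1)] adjoint_pairD[OF assms(2)])

lemma adjoint_pair_linear:
  assumes "adjoint_pair A B"
  shows "A (x + y) = A x + A y" "A (c *\<^sub>C x) = c *\<^sub>C A x" "A (x - y) = A x - A y"
  by (rule cinner_eq_imp_eq_left, simp add: adjoint_pairD[OF assms] cinner_linear)+

lemma adjoint_contraction:
  assumes AB: "adjoint_pair A B" and c: "\<And>x. norm (A x) \<le> norm x"
  shows "norm (B x) \<le> norm x"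
proof -
  have "(norm (B x))\<^sup>2 = Re (cinner (A (B x)) x)"
    by (simp add: norm_power2_cinner adjoint_pairD[OF AB])
  also have "\<dots> \<le> norm (A (B x)) * norm x"
    using cauchy_schwarz complex_Re_le_cmod order_trans by blast
  also have "\<dots> \<le> norm (B x) * norm x" by (intro mult_right_mono c) simp
  finally show ?thesis by (cases "B x = 0") (auto simp: power2_eq_square)
qed

lemma funpow_contraction:
  fixes A :: "'a::real_normed_vector \<Rightarrow> 'a"
  assumes "\<And>x. norm (A x) \<le> norm x"
  shows "norm ((A ^^ k) x) \<le> norm x"
proof (induction k)
  case (Suc k)
  then show ?case using assms[of "(A ^^ k) x"] by simp
qed simp

section \<open>The weakly stable part of a contraction\<close>

text \<open>The norms \<open>\<parallel>A\<^sup>k x\<parallel>\<close> decrease, so their differences tend to zero. Hence \<open>A\<close> is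
  asymptotically isometric along its orbits.\<close>

lemma asymptotically_isometric:
  assumes AB: "adjoint_pair A B" and c: "\<And>x. norm (A x) \<le> norm x"
  shows "(\<lambda>k. (B ^^ j) ((A ^^ j) ((A ^^ k) x)) - (A ^^ k) x) \<longlonglongrightarrow> 0"
proof -
  define r where "r k = (norm ((A ^^ k) x))\<^sup>2" for k
  have "decseq (\<lambda>k. norm ((A ^^ k) x))" by (rule decseq_SucI) (simp add: c)
  then have "decseq r" unfolding r_def decseq_def by (auto intro: power_mono)
  then obtain L where L: "r \<longlonglongrightarrow> L"
    using decseq_convergent[of r 0] by (auto simp: r_def)
  have "(\<lambda>k. r (k + j)) \<longlonglongrightarrow> L" using L by (rule LIMSEQ_ignore_initial_segment)
  then have "(\<lambda>k. sqrt (r k - r (k + j))) \<longlonglongrightarrow> sqrt (L - L)" by (intro tendsto_intros L)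
  then have lim: "(\<lambda>k. sqrt (r k - r (k + j))) \<longlonglongrightarrow> 0" by simp
  have "norm ((B ^^ j) ((A ^^ j) y) - y) \<le> sqrt ((norm y)\<^sup>2 - (norm ((A ^^ j) y))\<^sup>2)" for y
  proof -
    have ABj: "adjoint_pair (A ^^ j) (B ^^ j)" by (rule adjoint_pair_funpow[OF AB])
    have "norm ((B ^^ j) ((A ^^ j) y)) \<le> norm ((A ^^ j) y)"
      by (rule funpow_contraction) (rule adjoint_contraction[OF AB c])
    then have "(norm ((B ^^ j) ((A ^^ j) y)))\<^sup>2 \<le> (norm ((A ^^ j) y))\<^sup>2" by (intro power_mono) auto
    moreover have "Re (cinner ((B ^^ j) ((A ^^ j) y)) y) = (norm ((A ^^ j) y))\<^sup>2"
      by (simp add: adjoint_pairD[OF adjoint_pair_sym[OF ABj]] norm_power2_cinner)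
    ultimately have "(norm ((B ^^ j) ((A ^^ j) y) - y))\<^sup>2 \<le> (norm y)\<^sup>2 - (norm ((A ^^ j) y))\<^sup>2"
      by (simp add: norm_diff_power2)
    then show ?thesis by (rule real_le_rsqrt)
  qed
  from this[of "(A ^^ k) x" for k]
  have "norm ((B ^^ j) ((A ^^ j) ((A ^^ k) x)) - (A ^^ k) x) \<le> sqrt (r k - r (k + j))" for k
    by (simp add: r_def funpow_add add.commute[of k j])
  then show ?thesis by (intro Lim_null_comparison[OF _ lim]) auto
qed

definition weak_null_set :: "('a::complex_hilbert_space \<Rightarrow> 'a) \<Rightarrow> 'a set" where
  "weak_null_set A = {x. \<forall>y. (\<lambda>k. cinner ((A ^^ k) x) y) \<longlonglongrightarrow> 0}"

lemma cinner_null_if_null: "f \<longlonglongrightarrow> 0 \<Longrightarrow> (\<lambda>k. cinner (f k) y) \<longlonglongrightarrow> 0"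
proof -
  assume "f \<longlonglongrightarrow> 0"
  then have "(\<lambda>k. norm (f k) * norm y) \<longlonglongrightarrow> 0"
    using tendsto_mult_left_zero tendsto_norm_zero by blast
  then show ?thesis by (rule Lim_null_comparison[rotated]) (simp add: cauchy_schwarz)
qed

lemma closed_csubspace_weak_null_set:
  assumes AB: "adjoint_pair A B" and c: "\<And>x. norm (A x) \<le> norm x"
  shows "closed_csubspace (weak_null_set A)"
proof -
  have ABk: "adjoint_pair (A ^^ k) (B ^^ k)" for k by (rule adjoint_pair_funpow[OF AB])
  note lin = adjoint_pair_linear[OF ABk]
  have "closed {x. (\<lambda>k. cinner ((A ^^ k) x) y) \<longlonglongrightarrow> 0}" for y
  proof (rule closed_null_set_equicontinuous[where C = "norm y"])
    fix k x z
    have "cmod (cinner ((A ^^ k) x) y - cinner ((A ^^ k) z) y) \<le> norm ((A ^^ k) (x - z)) * norm y"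
      by (simp add: lin cauchy_schwarz flip: cinner_diff_left)
    also have "\<dots> \<le> norm (x - z) * norm y" by (intro mult_right_mono funpow_contraction c) simp
    finally show "cmod (cinner ((A ^^ k) x) y - cinner ((A ^^ k) z) y) \<le> norm y * dist x z"
      by (simp add: dist_norm mult.commute)
  qed
  moreover have "weak_null_set A = (\<Inter>y. {x. (\<lambda>k. cinner ((A ^^ k) x) y) \<longlonglongrightarrow> 0})"
    by (auto simp: weak_null_set_def)
  ultimately have "closed (weak_null_set A)" by auto
  moreover have "(A ^^ k) 0 = 0" for k using lin(2)[of k 0 0] by simp
  ultimately show ?thesis
    by (auto simp: closed_csubspace_def weak_null_set_def lin cinner_linear
        intro: tendsto_add_zero tendsto_mult_right_zero)
qed

text \<open>Let \<open>L\<close> be the closed subspace of all \<open>y\<close> with \<open>\<langle>B\<^sup>k x, y\<rangle> \<rightarrow> 0\<close>. Because \<open>B\<close> is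
  asymptotically isometric along the orbit of \<open>x\<close>, \<open>\<langle>B\<^sup>k x, B\<^sup>j x\<rangle>\<close> behaves like
  \<open>\<langle>x, A\<^bsup>k - j\<^esup> x\<rangle>\<close>, so \<open>L\<close> contains the orbit of \<open>x\<close> under \<open>B\<close>. But then \<open>L\<close> trivially contains
  its orthogonal complement, so it is the whole space.\<close>

theorem weak_null_set_subset_adjoint:
  assumes AB: "adjoint_pair A B" and c: "\<And>x. norm (A x) \<le> norm x"
  shows "weak_null_set A \<subseteq> weak_null_set B"
proof
  fix x assume x: "x \<in> weak_null_set A"
  note BA = adjoint_pair_sym[OF AB]
  have cB: "norm (B y) \<le> norm y" for y by (rule adjoint_contraction[OF AB c])
  define L where "L = {y. (\<lambda>k. cinner ((B ^^ k) x) y) \<longlonglongrightarrow> 0}"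
  have "closed L"
    unfolding L_def
  proof (rule closed_null_set_equicontinuous[where C = "norm x"])
    fix k y z
    have "cmod (cinner ((B ^^ k) x) (y - z)) \<le> norm x * norm (y - z)"
      by (rule order_trans[OF cauchy_schwarz mult_right_mono[OF funpow_contraction[OF cB]]]) simp
    then show "cmod (cinner ((B ^^ k) x) y - cinner ((B ^^ k) x) z) \<le> norm x * dist y z"
      by (simp add: dist_norm cinner_diff_right)
  qed
  then have L: "closed_csubspace L"
    by (auto simp: closed_csubspace_def L_def cinner_linear
        intro: tendsto_add_zero tendsto_mult_right_zero)
  have orbit: "(B ^^ j) x \<in> L" for j
  proof -
    have "(\<lambda>k. cinner ((A ^^ j) ((B ^^ j) ((B ^^ k) x)) - (B ^^ k) x) x) \<longlonglongrightarrow> 0"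
      by (intro cinner_null_if_null asymptotically_isometric[OF BA cB])
    moreover have "(\<lambda>k. cinner ((B ^^ k) x) x) \<longlonglongrightarrow> 0"
    proof -
      have "(\<lambda>k. cinner ((A ^^ k) x) x) \<longlonglongrightarrow> 0" using x by (simp add: weak_null_set_def)
      then have "(\<lambda>k. cnj (cinner ((A ^^ k) x) x)) \<longlonglongrightarrow> cnj 0" by (rule tendsto_cnj)
      moreover have "cnj (cinner ((A ^^ k) x) x) = cinner ((B ^^ k) x) x" for k
        by (metis AB adjoint_pairD adjoint_pair_funpow cinner_commute)
      ultimately show ?thesis by simp
    qed
    ultimately have "(\<lambda>k. cinner ((A ^^ j) ((B ^^ j) ((B ^^ k) x)) - (B ^^ k) x) x
        + cinner ((B ^^ k) x) x) \<longlonglongrightarrow> 0" by (rule tendsto_add_zero)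
    then have "(\<lambda>k. cinner ((B ^^ (k + j)) x) ((B ^^ j) x)) \<longlonglongrightarrow> 0"
      by (simp add: cinner_diff_left adjoint_pairD[OF adjoint_pair_funpow[OF AB]]
          funpow_add add.commute[of _ j])
    then show ?thesis unfolding L_def mem_Collect_eq by (rule LIMSEQ_offset)
  qed
  have "y \<in> L" for y
  proof -
    obtain u v where uv: "u \<in> L" "v \<in> orth_complement L" "y = u + v"
      using orthogonal_decomposition[OF L] by blast
    have "v \<in> L" unfolding L_def using orth_complement_sym[OF uv(2) orbit] by simp
    then show ?thesis using uv L by (simp add: csubspace_add)
  qed
  then show "x \<in> weak_null_set B" by (auto simp: weak_null_set_def L_def)
qed

corollary weak_null_set_adjoint:
  assumes "adjoint_pair A B" "\<And>x. norm (A x) \<le> norm x"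
  shows "weak_null_set A = weak_null_set B"
  using weak_null_set_subset_adjoint[OF assms]
    weak_null_set_subset_adjoint[OF adjoint_pair_sym[OF assms(1)] adjoint_contraction[OF assms]]
  by blast

lemma weak_null_set_invariant:
  assumes CD: "adjoint_pair C D" and comm: "\<And>x. A (C x) = C (A x)" and x: "x \<in> weak_null_set A"
  shows "C x \<in> weak_null_set A"
proof -
  have "(A ^^ k) (C x) = C ((A ^^ k) x)" for k by (induction k) (simp_all add: comm)
  then show ?thesis using x by (simp add: weak_null_set_def adjoint_pairD[OF CD])
qed

lemma orth_complement_invariant:
  assumes CD: "adjoint_pair C D" and D: "\<And>x. x \<in> M \<Longrightarrow> D x \<in> M" and x: "x \<in> orth_complement M"
  shows "C x \<in> orth_complement M"
  using x D by (simp add: orth_complement_def adjoint_pairD[OF CD])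

text \<open>Since \<open>(1 - B A) A\<^sup>k x \<rightarrow> 0\<close> for every \<open>x\<close>, the range of the self-adjoint operator \<open>1 - B A\<close>
  consists of weakly null vectors of \<open>B\<close>, hence of \<open>A\<close>. The operator vanishes therefore on the
  orthogonal complement, which it leaves invariant.\<close>

theorem isometric_off_weak_null_set:
  assumes AB: "adjoint_pair A B" and c: "\<And>x. norm (A x) \<le> norm x"
    and z: "z \<in> orth_complement (weak_null_set A)"
  shows "B (A z) = z"
proof -
  note BA = adjoint_pair_sym[OF AB]
  have E: "weak_null_set A = weak_null_set B" by (rule weak_null_set_adjoint[OF AB c])
  have "(\<lambda>k. cinner ((B ^^ k) (B (A z) - z)) y) \<longlonglongrightarrow> 0" for y
  proof -
    have "(\<lambda>k. cinner ((B ^^ 1) ((A ^^ 1) ((A ^^ k) y)) - (A ^^ k) y) z) \<longlonglongrightarrow> 0"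
      by (intro cinner_null_if_null asymptotically_isometric[OF AB c])
    then have "(\<lambda>k. cnj (cinner (B (A ((A ^^ k) y)) - (A ^^ k) y) z)) \<longlonglongrightarrow> cnj 0"
      by (intro tendsto_cnj) simp
    moreover have "cnj (cinner (B (A w) - w) z) = cinner (B (A z) - z) w" for w
      using cinner_commute[of z "B (A w) - w"]
      by (simp add: cinner_linear adjoint_pairD[OF AB] adjoint_pairD[OF BA])
    moreover have "cinner ((B ^^ k) w) y = cinner w ((A ^^ k) y)" for k w
      by (rule adjoint_pairD[OF adjoint_pair_funpow[OF BA]])
    ultimately show ?thesis by simp
  qed
  then have 1: "B (A z) - z \<in> weak_null_set A" by (simp add: E) (simp add: weak_null_set_def)
  have "A z \<in> orth_complement (weak_null_set A)"
    by (rule orth_complement_invariant[OF AB _ z])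
      (use weak_null_set_invariant[OF BA, of B] in \<open>simp add: E\<close>)
  then have "B (A z) \<in> orth_complement (weak_null_set A)"
    by (rule orth_complement_invariant[OF BA, rotated])
      (rule weak_null_set_invariant[OF AB], auto)
  then have "B (A z) - z \<in> orth_complement (weak_null_set A)"
    using z by (intro csubspace_diff closed_csubspace_orth_complement)
  then show ?thesis using orth_complement_Int[OF 1] by simp
qed

section \<open>The Koszul complex\<close>

lemma koszul_spaceD: "\<phi> \<in> koszul_space M n \<Longrightarrow> J \<subseteq> {1..n} \<Longrightarrow> \<phi> J \<in> M"
  by (auto simp: koszul_space_def)

lemma koszul_diff_eq:
  "J \<subseteq> {1..n} \<Longrightarrow>
    koszul_diff n A \<phi> J = (\<Sum>j\<in>J. (- 1) ^ card {i\<in>J. i < j} *\<^sub>C A j (\<phi> (J - {j})))"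
  by (simp add: koszul_diff_def)

lemma koszul_diff_in_space:
  assumes "closed_csubspace M" "\<And>j x. j \<in> {1..n} \<Longrightarrow> x \<in> M \<Longrightarrow> A j x \<in> M"
    and "\<phi> \<in> koszul_space M n"
  shows "koszul_diff n A \<phi> \<in> koszul_space M n"
proof -
  have "koszul_diff n A \<phi> J \<in> M" if "J \<subseteq> {1..n}" for J
    unfolding koszul_diff_eq[OF that] using that
    by (intro csubspace_sum csubspace_scaleC assms koszul_spaceD[OF assms(3)]) auto
  then show ?thesis by (auto simp: koszul_space_def koszul_diff_def)
qed

text \<open>In \<open>d\<^sup>2 \<phi>\<close> the terms for the ordered pairs \<open>(j, i)\<close> and \<open>(i, j)\<close> cancel: removing the
  smaller of the two indices first changes the sign of the other by \<open>- 1\<close>.\<close>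

lemma koszul_diff_koszul_diff:
  assumes lin: "\<And>j. j \<in> {1..n} \<Longrightarrow> bounded_op_on UNIV (A j)"
    and comm: "\<And>i j x. i \<in> {1..n} \<Longrightarrow> j \<in> {1..n} \<Longrightarrow> A i (A j x) = A j (A i x)"
    and J: "J \<subseteq> {1..n}"
  shows "koszul_diff n A (koszul_diff n A \<phi>) J = 0"
proof -
  have fin: "finite J" using J finite_subset by blast
  define s :: "nat set \<Rightarrow> nat \<Rightarrow> complex" where "s J j = (- 1) ^ card {i\<in>J. i < j}" for J j
  define g where "g j i = (s J j * s (J - {j}) i) *\<^sub>C A j (A i (\<phi> (J - {j} - {i})))" for j i
  have anti_less: "s J j * s (J - {j}) i = - (s J i * s (J - {i}) j)"
    if "i \<in> J" "j \<in> J" "i < j" for i j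
  proof -
    have "{k \<in> J - {j}. k < i} = {k \<in> J. k < i}" using that by auto
    moreover have "{k \<in> J. k < j} = insert i {k \<in> J - {i}. k < j}" using that by auto
    then have "card {k \<in> J. k < j} = Suc (card {k \<in> J - {i}. k < j})"
      using fin by (simp add: card_insert_disjoint)
    ultimately show ?thesis by (simp add: s_def mult.commute)
  qed
  have anti: "s J j * s (J - {j}) i = - (s J i * s (J - {i}) j)" if "i \<in> J" "j \<in> J" "i \<noteq> j" for i j
    using anti_less[of i j] anti_less[of j i] that by (cases "i < j") auto
  define K where "K = (SIGMA j:J. J - {j})"
  have "koszul_diff n A (koszul_diff n A \<phi>) J =
      (\<Sum>j\<in>J. s J j *\<^sub>C A j (\<Sum>i\<in>J - {j}. s (J - {j}) i *\<^sub>C A i (\<phi> (J - {j} - {i}))))"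
    using J unfolding koszul_diff_eq[OF J] s_def
    by (intro sum.cong refl) (subst koszul_diff_eq, auto)
  also have "\<dots> = (\<Sum>j\<in>J. \<Sum>i\<in>J - {j}. g j i)"
  proof (intro sum.cong refl)
    fix j assume "j \<in> J"
    then have lj: "bounded_op_on UNIV (A j)" using lin J by blast
    show "s J j *\<^sub>C A j (\<Sum>i\<in>J - {j}. s (J - {j}) i *\<^sub>C A i (\<phi> (J - {j} - {i})))
        = (\<Sum>i\<in>J - {j}. g j i)"
      by (simp add: g_def op_sum[OF lj] op_scaleC[OF lj] scaleC_sum_right scaleC_scaleC)
  qed
  also have "\<dots> = (\<Sum>(j, i)\<in>K. g j i)" unfolding K_def using fin by (subst sum.Sigma) auto
  finally have d: "koszul_diff n A (koszul_diff n A \<phi>) J = (\<Sum>(j, i)\<in>K. g j i)" .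
  have "(\<Sum>(j, i)\<in>K. g j i) = (\<Sum>(j, i)\<in>K. g i j)"
    by (rule sum.reindex_bij_witness[where i = prod.swap and j = prod.swap]) (auto simp: K_def)
  also have "\<dots> = (\<Sum>(j, i)\<in>K. - g j i)"
  proof (intro sum.cong refl, clarify)
    fix j i assume "(j, i) \<in> K"
    then have ij: "i \<in> J" "j \<in> J" "i \<noteq> j" by (auto simp: K_def)
    have "A i (A j x) = A j (A i x)" for x using comm ij J by blast
    moreover have "J - {i} - {j} = J - {j} - {i}" by auto
    ultimately show "g i j = - g j i" by (simp add: g_def anti[OF ij] scaleC_minus_left)
  qed
  also have "\<dots> = - (\<Sum>(j, i)\<in>K. g j i)" by (simp add: case_prod_unfold sum_negf)
  finally have "2 *\<^sub>R (\<Sum>(j, i)\<in>K. g j i) = 0"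
    by (simp add: scaleR_2 eq_neg_iff_add_eq_0)
  then show ?thesis by (simp add: d)
qed

text \<open>A projection that commutes with the \<open>A j\<close> maps any preimage under the differential
  to one with coefficients in \<open>M\<close>.\<close>

lemma koszul_exact_subspace:
  assumes M: "closed_csubspace M"
    and lin: "\<And>j. j \<in> {1..n} \<Longrightarrow> bounded_op_on UNIV (A j)"
    and inv: "\<And>j x. j \<in> {1..n} \<Longrightarrow> x \<in> M \<Longrightarrow> A j x \<in> M"
    and inv': "\<And>j x. j \<in> {1..n} \<Longrightarrow> x \<in> orth_complement M \<Longrightarrow> A j x \<in> orth_complement M"
    and ex: "koszul_exact UNIV n A"
  shows "koszul_exact M n A"
  unfolding koszul_exact_def
proof (intro equalityI subsetI)
  fix \<phi> assume "\<phi> \<in> {\<phi> \<in> koszul_space M n. \<forall>J\<in>Pow {1..n}. koszul_diff n A \<phi> J = 0}"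
  then have \<phi>: "\<phi> \<in> koszul_space M n" and 0: "\<forall>J\<in>Pow {1..n}. koszul_diff n A \<phi> J = 0" by auto
  then have "\<phi> \<in> koszul_space UNIV n" by (auto simp: koszul_space_def)
  then obtain \<psi> where \<psi>: "\<phi> = koszul_diff n A \<psi>"
    using ex 0 unfolding koszul_exact_def by blast
  have "\<exists>u. u \<in> M \<and> x - u \<in> orth_complement M" for x
    using orthogonal_decomposition[OF M, of x] by (metis add_diff_cancel_left')
  then obtain Q where Q: "\<And>x. Q x \<in> M" "\<And>x. x - Q x \<in> orth_complement M" by metis
  define \<theta> where "\<theta> = (\<lambda>J\<in>Pow {1..n}. Q (\<psi> J))"
  have \<theta>: "\<theta> \<in> koszul_space M n" by (auto simp: \<theta>_def koszul_space_def Q)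
  have "koszul_diff n A \<theta> J = \<phi> J" for J
  proof (cases "J \<subseteq> {1..n}")
    case False
    then show ?thesis by (simp add: \<psi> koszul_diff_def)
  next
    case True
    have "\<phi> J - koszul_diff n A \<theta> J =
        (\<Sum>j\<in>J. (- 1) ^ card {i\<in>J. i < j} *\<^sub>C A j (\<psi> (J - {j}) - Q (\<psi> (J - {j}))))"
      unfolding \<psi> koszul_diff_eq[OF True] sum_subtractf [symmetric]
      using True lin
      by (intro sum.cong refl) (auto simp: \<theta>_def op_diff scaleC_diff_right subset_iff)
    also have "\<dots> \<in> orth_complement M"
      using True by (intro csubspace_sum csubspace_scaleC closed_csubspace_orth_complement inv' Q) auto
    finally have 1: "\<phi> J - koszul_diff n A \<theta> J \<in> orth_complement M" .
    have "\<phi> J - koszul_diff n A \<theta> J \<in> M"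
      by (intro csubspace_diff M koszul_spaceD[OF \<phi>] True
          koszul_spaceD[OF koszul_diff_in_space[of M n A, OF M inv \<theta>]])
    then show ?thesis using 1 orth_complement_Int by fastforce
  qed
  then have "\<phi> = koszul_diff n A \<theta>" by auto
  then show "\<phi> \<in> koszul_diff n A ` koszul_space M n" using \<theta> by blast
next
  fix \<phi> assume "\<phi> \<in> koszul_diff n A ` koszul_space M n"
  then obtain \<psi> where \<psi>: "\<psi> \<in> koszul_space M n" "\<phi> = koszul_diff n A \<psi>" by blast
  then have "\<phi> \<in> koszul_space M n" using koszul_diff_in_space[of M n A, OF M inv] by blast
  moreover have "\<psi> \<in> koszul_space UNIV n" using \<psi>(1) by (auto simp: koszul_space_def)
  then have "\<forall>J\<in>Pow {1..n}. koszul_diff n A \<phi> J = 0"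
    using ex \<psi>(2) unfolding koszul_exact_def by blast
  ultimately show "\<phi> \<in> {\<phi> \<in> koszul_space M n. \<forall>J\<in>Pow {1..n}. koszul_diff n A \<phi> J = 0}" by blast
qed

text \<open>If the last operator has an inverse \<open>B\<close> commuting with the others, then contraction
  against the last basis vector followed by \<open>B\<close> is a homotopy from the identity to zero.\<close>

lemma koszul_exact_if_last_invertible:
  assumes n: "n \<ge> 1" and M: "closed_csubspace M"
    and lin: "\<And>j. j \<in> {1..n} \<Longrightarrow> bounded_op_on UNIV (A j)"
    and comm: "\<And>i j x. i \<in> {1..n} \<Longrightarrow> j \<in> {1..n} \<Longrightarrow> A i (A j x) = A j (A i x)"
    and inv: "\<And>j x. j \<in> {1..n} \<Longrightarrow> x \<in> M \<Longrightarrow> A j x \<in> M"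
    and BM: "\<And>x. x \<in> M \<Longrightarrow> B x \<in> M"
    and AB: "\<And>x. x \<in> M \<Longrightarrow> A n (B x) = x" and BA: "\<And>x. x \<in> M \<Longrightarrow> B (A n x) = x"
  shows "koszul_exact M n A"
  unfolding koszul_exact_def
proof (intro equalityI subsetI)
  fix \<phi> assume "\<phi> \<in> koszul_diff n A ` koszul_space M n"
  then show "\<phi> \<in> {\<phi> \<in> koszul_space M n. \<forall>J\<in>Pow {1..n}. koszul_diff n A \<phi> J = 0}"
    using koszul_diff_in_space[of M n A, OF M inv] koszul_diff_koszul_diff[of n A, OF lin comm] by blast
next
  fix \<phi> assume "\<phi> \<in> {\<phi> \<in> koszul_space M n. \<forall>J\<in>Pow {1..n}. koszul_diff n A \<phi> J = 0}"
  then have \<phi>: "\<phi> \<in> koszul_space M n" and cyc: "\<And>J. J \<subseteq> {1..n} \<Longrightarrow> koszul_diff n A \<phi> J = 0" by auto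
  \<comment> \<open>The index \<open>n\<close> comes last, so the sign is that of moving \<open>e\<^sub>n\<close> past all of \<open>e\<^sub>J\<close>.\<close>
  define \<psi> where "\<psi> = (\<lambda>J\<in>Pow {1..n}. if n \<in> J then 0 else (- 1) ^ card J *\<^sub>C B (\<phi> (insert n J)))"
  have \<psi>: "\<psi> \<in> koszul_space M n"
    using n by (simp add: koszul_space_def \<psi>_def csubspace_zero[OF M] csubspace_scaleC[OF M]
        BM koszul_spaceD[OF \<phi>])
  have ln: "bounded_op_on UNIV (A n)" using lin n by simp
  have "koszul_diff n A \<psi> J = \<phi> J" if J: "J \<subseteq> {1..n}" for J
  proof -
    have fin: "finite J" using J finite_subset by blast
    have dM: "koszul_diff n A \<psi> J \<in> M" by (rule koszul_spaceD[OF koszul_diff_in_space[of M n A, OF M inv \<psi>] J])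
    show ?thesis
    proof (cases "n \<in> J")
      case True
      have "{i \<in> J. i < n} = J - {n}" using J by force
      then have c: "card {i \<in> J. i < n} = card (J - {n})" by simp
      have "koszul_diff n A \<psi> J = (\<Sum>j\<in>{n}. (- 1) ^ card {i\<in>J. i < j} *\<^sub>C A j (\<psi> (J - {j})))"
        unfolding koszul_diff_eq[OF J] using fin True J
        by (intro sum.mono_neutral_right) (auto simp: \<psi>_def op_zero[OF lin] subset_iff)
      also have "\<dots> = A n (B (\<phi> J))"
        using J True by (simp add: c \<psi>_def op_scaleC[OF ln] scaleC_scaleC insert_absorb subset_iff
            flip: power_mult_distrib)
      also have "\<dots> = \<phi> J" by (intro AB koszul_spaceD[OF \<phi> J])
      finally show ?thesis .
    next
      case False
      have Jn: "insert n J \<subseteq> {1..n}" using J n by simp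
      have lt: "j < n" if "j \<in> J" for j using that J False by (metis atLeastAtMost_iff nat_less_le subsetD)
      have c: "{i \<in> insert n J. i < n} = J" using lt by auto
      have c': "{i \<in> insert n J. i < j} = {i \<in> J. i < j}" if "j \<in> J" for j using lt[OF that] by auto
      have cJ: "Suc (card (J - {j})) = card J" if "j \<in> J" for j
        using card_Suc_Diff1[OF fin that] .
      have eq: "\<phi> (insert n (J - {j})) = A n (B (\<phi> (insert n (J - {j}))))" if "j \<in> J" for j
        using Jn by (intro AB[symmetric] koszul_spaceD[OF \<phi>]) auto
      have 0: "(- 1) ^ card J *\<^sub>C A n (\<phi> J)
          + (\<Sum>j\<in>J. (- 1) ^ card {i\<in>J. i < j} *\<^sub>C A j (\<phi> (insert n (J - {j})))) = 0"
      proof -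
        have "0 = (\<Sum>j\<in>insert n J. (- 1) ^ card {i\<in>insert n J. i < j} *\<^sub>C A j (\<phi> (insert n J - {j})))"
          using cyc[OF Jn] by (simp only: koszul_diff_eq[OF Jn])
        also have "\<dots> = (- 1) ^ card J *\<^sub>C A n (\<phi> J)
            + (\<Sum>j\<in>J. (- 1) ^ card {i\<in>insert n J. i < j} *\<^sub>C A j (\<phi> (insert n J - {j})))"
          unfolding sum.insert[OF fin False] c using False by simp
        also have "(\<Sum>j\<in>J. (- 1) ^ card {i\<in>insert n J. i < j} *\<^sub>C A j (\<phi> (insert n J - {j})))
            = (\<Sum>j\<in>J. (- 1) ^ card {i\<in>J. i < j} *\<^sub>C A j (\<phi> (insert n (J - {j}))))"
        proof (intro sum.cong refl)
          fix j assume j: "j \<in> J"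
          then have "insert n J - {j} = insert n (J - {j})" using False by auto
          then show "(- 1) ^ card {i\<in>insert n J. i < j} *\<^sub>C A j (\<phi> (insert n J - {j}))
              = (- 1) ^ card {i\<in>J. i < j} *\<^sub>C A j (\<phi> (insert n (J - {j})))"
            by (simp only: c'[OF j])
        qed
        finally show ?thesis by simp
      qed
      have "(- 1) ^ card J *\<^sub>C A n (koszul_diff n A \<psi> J)
          = (\<Sum>j\<in>J. (- 1) ^ card {i\<in>J. i < j} *\<^sub>C
              ((- 1) ^ card J * (- 1) ^ card (J - {j})) *\<^sub>C A j (\<phi> (insert n (J - {j}))))"
        unfolding koszul_diff_eq[OF J] op_sum[OF ln] scaleC_sum_right
      proof (intro sum.cong refl)
        fix j assume j: "j \<in> J"
        have lj: "bounded_op_on UNIV (A j)" and jn: "j \<in> {1..n}" using j J lin by auto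
        have "\<psi> (J - {j}) = (- 1) ^ card (J - {j}) *\<^sub>C B (\<phi> (insert n (J - {j})))"
          using J False by (auto simp: \<psi>_def)
        then have "A n (A j (\<psi> (J - {j}))) = (- 1) ^ card (J - {j}) *\<^sub>C A j (\<phi> (insert n (J - {j})))"
          using comm[of n j] jn n
          by (simp add: op_scaleC[OF lj] op_scaleC[OF ln] flip: eq[OF j])
        then show "(- 1) ^ card J *\<^sub>C A n ((- 1) ^ card {i\<in>J. i < j} *\<^sub>C A j (\<psi> (J - {j})))
            = (- 1) ^ card {i\<in>J. i < j} *\<^sub>C
              ((- 1) ^ card J * (- 1) ^ card (J - {j})) *\<^sub>C A j (\<phi> (insert n (J - {j})))"
          by (simp add: op_scaleC[OF ln] scaleC_scaleC mult_ac)
      qed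
      also have "\<dots> = (\<Sum>j\<in>J. - ((- 1) ^ card {i\<in>J. i < j} *\<^sub>C A j (\<phi> (insert n (J - {j})))))"
      proof (intro sum.cong refl)
        fix j assume j: "j \<in> J"
        have "(- 1 :: complex) ^ card J * (- 1) ^ card (J - {j}) = - 1"
          by (simp add: cJ[OF j, symmetric] flip: power_mult_distrib)
        then show "(- 1) ^ card {i\<in>J. i < j} *\<^sub>C
              ((- 1) ^ card J * (- 1) ^ card (J - {j})) *\<^sub>C A j (\<phi> (insert n (J - {j})))
            = - ((- 1) ^ card {i\<in>J. i < j} *\<^sub>C A j (\<phi> (insert n (J - {j}))))"
          by (simp add: scaleC_minus_right)
      qed
      also have "\<dots> = (- 1) ^ card J *\<^sub>C A n (\<phi> J)"
        using 0 by (simp add: sum_negf add_eq_0_iff)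
      finally have "(- 1) ^ card J *\<^sub>C (- 1) ^ card J *\<^sub>C A n (koszul_diff n A \<psi> J)
          = (- 1) ^ card J *\<^sub>C (- 1) ^ card J *\<^sub>C A n (\<phi> J)" by simp
      then have "A n (koszul_diff n A \<psi> J) = A n (\<phi> J)"
        by (simp add: scaleC_scaleC flip: power_mult_distrib)
      then show ?thesis using BA[OF dM] BA[OF koszul_spaceD[OF \<phi> J]] by metis
    qed
  qed
  moreover have "koszul_diff n A \<psi> J = \<phi> J" if "\<not> J \<subseteq> {1..n}" for J
    using that \<phi> by (auto simp: koszul_diff_def koszul_space_def PiE_def extensional_def)
  ultimately have "\<phi> = koszul_diff n A \<psi>" by (metis ext)
  then show "\<phi> \<in> koszul_diff n A ` koszul_space M n" using \<psi> by blast
qed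

section \<open>Polynomials in commuting operators\<close>

lemma
  assumes "commuting_tuple_on UNIV n T"
  shows tuple_bounded: "i \<in> {1..n} \<Longrightarrow> bounded_op_on UNIV (T i)"
    and tuple_commute: "i \<in> {1..n} \<Longrightarrow> j \<in> {1..n} \<Longrightarrow> T i (T j x) = T j (T i x)"
  using assms by (auto simp: commuting_tuple_on_def)

lemma bounded_opI:
  assumes "\<And>x y. A (x + y) = A x + A y" "\<And>c x. A (c *\<^sub>C x) = c *\<^sub>C A x"
    "\<And>x. norm (A x) \<le> B * norm x"
  shows "bounded_op_on UNIV A"
  using assms by (auto simp: bounded_op_on_def)

lemma bounded_op_compose:
  assumes A: "bounded_op_on UNIV A" and B: "bounded_op_on UNIV B"
  shows "bounded_op_on UNIV (\<lambda>x. A (B x))"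
proof -
  obtain a where a: "a \<ge> 0" "\<And>x. norm (A x) \<le> a * norm x" using bounded_op_bound[OF A] by blast
  obtain b where b: "b \<ge> 0" "\<And>x. norm (B x) \<le> b * norm x" using bounded_op_bound[OF B] by blast
  have "norm (A (B x)) \<le> (a * b) * norm x" for x
    using order_trans[OF a(2)[of "B x"] mult_left_mono[OF b(2)[of x] a(1)]] by (simp add: mult.assoc)
  then show ?thesis
    by (intro bounded_opI) (auto simp: op_add[OF A] op_add[OF B] op_scaleC[OF A] op_scaleC[OF B])
qed

lemma bounded_op_ident: "bounded_op_on UNIV (\<lambda>x. x)"
  by (rule bounded_opI[where B = 1]) auto

lemma bounded_op_funpow: "bounded_op_on UNIV A \<Longrightarrow> bounded_op_on UNIV (A ^^ k)"
  by (induction k) (auto simp: bounded_op_ident id_def comp_def intro: bounded_op_compose)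

lemma bounded_op_scaled:
  assumes A: "bounded_op_on UNIV A"
  shows "bounded_op_on UNIV (\<lambda>x. c *\<^sub>C A x)"
proof -
  obtain a where a: "a \<ge> 0" "\<And>x. norm (A x) \<le> a * norm x" using bounded_op_bound[OF A] by blast
  have "norm (c *\<^sub>C A x) \<le> (cmod c * a) * norm x" for x
    using mult_left_mono[OF a(2)[of x], of "cmod c"] by (simp add: norm_scaleC mult.assoc)
  then show ?thesis
    by (intro bounded_opI[where B = "cmod c * a"])
      (simp_all add: op_add[OF A] op_scaleC[OF A] scaleC_add_right scaleC_scaleC mult.commute[of c])
qed

lemma bounded_op_plus:
  assumes A: "bounded_op_on UNIV A" and B: "bounded_op_on UNIV B"
  shows "bounded_op_on UNIV (\<lambda>x. A x + B x)"
proof -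
  obtain a where a: "a \<ge> 0" "\<And>x. norm (A x) \<le> a * norm x" using bounded_op_bound[OF A] by blast
  obtain b where b: "b \<ge> 0" "\<And>x. norm (B x) \<le> b * norm x" using bounded_op_bound[OF B] by blast
  have "norm (A x + B x) \<le> (a + b) * norm x" for x
    using norm_triangle_ineq[of "A x" "B x"] a(2)[of x] b(2)[of x] by (simp add: distrib_right)
  then show ?thesis
    by (intro bounded_opI)
      (auto simp: op_add[OF A] op_add[OF B] op_scaleC[OF A] op_scaleC[OF B] scaleC_add_right)
qed

lemma bounded_op_sum:
  "(\<And>i. i \<in> I \<Longrightarrow> bounded_op_on UNIV (A i)) \<Longrightarrow> bounded_op_on UNIV (\<lambda>x. \<Sum>i\<in>I. A i x)"
proof (induction I rule: infinite_finite_induct)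
  case (insert i I)
  then show ?case by (simp add: bounded_op_plus)
qed (auto intro!: bounded_opI[where B = 0])

lemma bounded_op_foldr:
  "(\<And>i. i \<in> set xs \<Longrightarrow> bounded_op_on UNIV (A i)) \<Longrightarrow> bounded_op_on UNIV (foldr A xs)"
proof (induction xs)
  case Nil
  then show ?case by (simp add: bounded_op_ident id_def)
next
  case (Cons a xs)
  then show ?case using bounded_op_compose[of "A a" "foldr A xs"] by (simp add: comp_def)
qed

lemma bounded_op_monomial: "commuting_tuple_on UNIV n T \<Longrightarrow> bounded_op_on UNIV (monomial_op n m T)"
  unfolding monomial_op_def by (intro bounded_op_foldr bounded_op_funpow tuple_bounded) auto

lemma bounded_op_poly: "commuting_tuple_on UNIV n T \<Longrightarrow> bounded_op_on UNIV (poly_op n p T)"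
  unfolding poly_op_def by (intro bounded_op_sum bounded_op_scaled bounded_op_monomial)

lemma funpow_in: "(\<And>x. x \<in> M \<Longrightarrow> A x \<in> M) \<Longrightarrow> x \<in> M \<Longrightarrow> (A ^^ k) x \<in> M"
  by (induction k) auto

lemma foldr_in: "(\<And>i x. i \<in> set xs \<Longrightarrow> x \<in> M \<Longrightarrow> A i x \<in> M) \<Longrightarrow> x \<in> M \<Longrightarrow> foldr A xs x \<in> M"
  by (induction xs) auto

lemma poly_op_in:
  assumes M: "closed_csubspace M" and T: "\<And>i x. i \<in> {1..n} \<Longrightarrow> x \<in> M \<Longrightarrow> T i x \<in> M" and x: "x \<in> M"
  shows "poly_op n p T x \<in> M"
  unfolding poly_op_def monomial_op_def
  by (intro csubspace_sum[OF M] csubspace_scaleC[OF M] foldr_in x funpow_in T) auto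

lemma funpow_commute: "(\<And>x. C (A x) = A (C x)) \<Longrightarrow> C ((A ^^ k) x) = (A ^^ k) (C x)"
  by (induction k) auto

lemma foldr_commute:
  "(\<And>i x. i \<in> set xs \<Longrightarrow> C (A i x) = A i (C x)) \<Longrightarrow> C (foldr A xs x) = foldr A xs (C x)"
  by (induction xs) auto

lemma foldr_funpow_add:
  assumes "\<And>i j x. i \<in> set xs \<Longrightarrow> j \<in> set xs \<Longrightarrow> A i (A j x) = A j (A i x)"
  shows "foldr (\<lambda>i. A i ^^ (a i + b i)) xs x = foldr (\<lambda>i. A i ^^ a i) xs (foldr (\<lambda>i. A i ^^ b i) xs x)"
  using assms
proof (induction xs)
  case (Cons j xs)
  have "(A j ^^ b j) (foldr (\<lambda>i. A i ^^ a i) xs y) = foldr (\<lambda>i. A i ^^ a i) xs ((A j ^^ b j) y)" for y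
  proof (rule foldr_commute)
    fix i x assume "i \<in> set xs"
    then have "A i (A j x) = A j (A i x)" for x using Cons.prems by simp
    then have "A i ((A j ^^ b j) x) = (A j ^^ b j) (A i x)" for x by (intro funpow_commute)
    then show "(A j ^^ b j) ((A i ^^ a i) x) = (A i ^^ a i) ((A j ^^ b j) x)"
      by (intro funpow_commute) simp
  qed
  then show ?case using Cons by (simp add: funpow_add)
qed simp

lemma monomial_op_add:
  assumes "commuting_tuple_on UNIV n T"
  shows "monomial_op n (a + b) T x = monomial_op n a T (monomial_op n b T x)"
  unfolding monomial_op_def lookup_add
  by (rule foldr_funpow_add) (auto intro!: tuple_commute[OF assms])

lemma foldr_funpow_single:
  "distinct xs \<Longrightarrow> foldr (\<lambda>j. T j ^^ (k when i = j)) xs x = (if i \<in> set xs then (T i ^^ k) x else x)"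
  by (induction xs) (auto simp: when_def)

lemma monomial_op_single:
  "i \<in> {1..n} \<Longrightarrow> monomial_op n (Poly_Mapping.single i k) T x = (T i ^^ k) x"
  unfolding monomial_op_def lookup_single by (subst foldr_funpow_single) auto

lemma monomial_op_trivial:
  assumes "\<And>i. i \<in> {1..n} \<Longrightarrow> Poly_Mapping.lookup m i = 0"
  shows "monomial_op n m T x = x"
proof -
  have "foldr (\<lambda>i. T i ^^ Poly_Mapping.lookup m i) xs x = x" if "set xs \<subseteq> {1..n}" for xs
    using that assms by (induction xs) auto
  from this[of "[1..<Suc n]"] show ?thesis by (simp add: monomial_op_def atLeastLessThanSuc_atLeastAtMost del: upt_Suc)
qed

lemma scaleC_sum_left: "(\<Sum>i\<in>I. f i) *\<^sub>C (x::'a::complex_hilbert_space) = (\<Sum>i\<in>I. f i *\<^sub>C x)"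
  by (induction I rule: infinite_finite_induct) (auto simp: scaleC_add_left)

lemma poly_op_superset:
  "finite K \<Longrightarrow> Poly_Mapping.keys p \<subseteq> K \<Longrightarrow>
    poly_op n p T x = (\<Sum>m\<in>K. Poly_Mapping.lookup p m *\<^sub>C monomial_op n m T x)"
  unfolding poly_op_def by (rule sum.mono_neutral_left) (auto simp: in_keys_iff)

lemma poly_at_superset:
  "finite K \<Longrightarrow> Poly_Mapping.keys p \<subseteq> K \<Longrightarrow>
    poly_at n p z = (\<Sum>m\<in>K. Poly_Mapping.lookup p m * (\<Prod>i\<in>{1..n}. z i ^ Poly_Mapping.lookup m i))"
  unfolding poly_at_def by (rule sum.mono_neutral_left) (auto simp: in_keys_iff)

lemma poly_op_add: "poly_op n (p + q) T x = poly_op n p T x + poly_op n q T x"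
proof -
  let ?K = "Poly_Mapping.keys p \<union> Poly_Mapping.keys q"
  have "finite ?K" "Poly_Mapping.keys (p + q) \<subseteq> ?K" by (auto simp: in_keys_iff lookup_add)
  then show ?thesis
    by (simp add: poly_op_superset[of ?K] lookup_add scaleC_add_left sum.distrib)
qed

lemma poly_at_add: "poly_at n (p + q) z = poly_at n p z + poly_at n q z"
proof -
  let ?K = "Poly_Mapping.keys p \<union> Poly_Mapping.keys q"
  have "finite ?K" "Poly_Mapping.keys (p + q) \<subseteq> ?K" by (auto simp: in_keys_iff lookup_add)
  then show ?thesis
    by (simp add: poly_at_superset[of ?K] lookup_add distrib_right sum.distrib)
qed

lemma poly_op_single: "poly_op n (Poly_Mapping.single m c) T x = c *\<^sub>C monomial_op n m T x"
  by (subst poly_op_superset[of "{m}"]) auto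

lemma poly_at_single:
  "poly_at n (Poly_Mapping.single m c) z = c * (\<Prod>i\<in>{1..n}. z i ^ Poly_Mapping.lookup m i)"
  by (subst poly_at_superset[of "{m}"]) auto

lemma polys_in_add: "p \<in> polys_in n \<Longrightarrow> q \<in> polys_in n \<Longrightarrow> p + q \<in> polys_in n"
  unfolding polys_in_def using Poly_Mapping.keys_add[of p q] by blast

lemma polys_in_single: "Poly_Mapping.keys m \<subseteq> {1..n} \<Longrightarrow> Poly_Mapping.single m c \<in> polys_in n"
  by (auto simp: polys_in_def)

lemma prod_power_single:
  fixes z :: "nat \<Rightarrow> complex"
  assumes "i \<in> {1..n}"
  shows "(\<Prod>j\<in>{1..n}. z j ^ Poly_Mapping.lookup (Poly_Mapping.single i (Suc 0)) j) = z i"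
proof -
  have "(\<Prod>j\<in>{1..n}. z j ^ Poly_Mapping.lookup (Poly_Mapping.single i (Suc 0)) j)
      = (\<Prod>j\<in>{1..n}. if j = i then z j else 1)"
    by (intro prod.cong) (auto simp: lookup_single when_def)
  then show ?thesis using assms by simp
qed

definition var :: "nat \<Rightarrow> cmpoly" where
  "var i = Poly_Mapping.single (Poly_Mapping.single i (Suc 0)) 1"

text \<open>The polynomials \<open>a z\<^sub>i z\<^sub>n + b z\<^sub>n\<^sub>-\<^sub>i + c z\<^sub>n\<close> are the ones that detect \<open>T\<^sub>i\<^sup>* = T\<^sub>n\<^sub>-\<^sub>i T\<^sub>n\<^sup>*\<close> where
  \<open>T\<^sub>n\<close> is unitary.\<close>

definition quad_poly :: "nat \<Rightarrow> nat \<Rightarrow> complex \<Rightarrow> complex \<Rightarrow> complex \<Rightarrow> cmpoly" where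
  "quad_poly n i a b c =
     Poly_Mapping.single (Poly_Mapping.single i (Suc 0) + Poly_Mapping.single n (Suc 0)) a
     + (Poly_Mapping.single (Poly_Mapping.single (n - i) (Suc 0)) b
     + Poly_Mapping.single (Poly_Mapping.single n (Suc 0)) c)"

lemma var_in: "i \<in> {1..n} \<Longrightarrow> var i \<in> polys_in n"
  unfolding var_def by (rule polys_in_single) auto

lemma poly_at_var: "i \<in> {1..n} \<Longrightarrow> poly_at n (var i) z = z i"
  unfolding var_def poly_at_single by (simp only: prod_power_single mult_1)

lemma poly_op_var: "i \<in> {1..n} \<Longrightarrow> poly_op n (var i) T x = T i x"
  unfolding var_def poly_op_single by (simp add: monomial_op_single)

lemma quad_poly:
  assumes i: "i \<in> {1..n - 1}"
  shows quad_poly_in: "quad_poly n i a b c \<in> polys_in n"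
    and poly_at_quad: "poly_at n (quad_poly n i a b c) z = a * (z i * z n) + b * z (n - i) + c * z n"
    and poly_op_quad: "commuting_tuple_on UNIV n T \<Longrightarrow>
      poly_op n (quad_poly n i a b c) T x = a *\<^sub>C T i (T n x) + b *\<^sub>C T (n - i) x + c *\<^sub>C T n x"
proof -
  have i: "i \<in> {1..n}" "n - i \<in> {1..n}" "n \<in> {1..n}" using i by auto
  have "Poly_Mapping.keys (Poly_Mapping.single i (Suc 0) + Poly_Mapping.single n (Suc 0)) \<subseteq> {1..n}"
    using Poly_Mapping.keys_add[of "Poly_Mapping.single i (Suc 0)" "Poly_Mapping.single n (Suc 0)"] i
    by fastforce
  then show "quad_poly n i a b c \<in> polys_in n"
    unfolding quad_poly_def using i by (intro polys_in_add polys_in_single) auto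
  show "poly_at n (quad_poly n i a b c) z = a * (z i * z n) + b * z (n - i) + c * z n"
    unfolding quad_poly_def poly_at_add poly_at_single lookup_add power_add prod.distrib
    using prod_power_single[OF i(1)] prod_power_single[OF i(2)] prod_power_single[OF i(3)]
    by simp
  show "poly_op n (quad_poly n i a b c) T x = a *\<^sub>C T i (T n x) + b *\<^sub>C T (n - i) x + c *\<^sub>C T n x"
    if "commuting_tuple_on UNIV n T"
    unfolding quad_poly_def poly_op_add poly_op_single monomial_op_add[OF that]
    using i by (simp add: monomial_op_single add.assoc)
qed

lemma
  shows poly_at_one: "poly_at n 1 z = 1"
    and poly_op_one: "poly_op n 1 T x = x"
    and one_in: "1 \<in> polys_in n"
  using poly_at_single[of n 0 1 z] poly_op_single[of n 0 1 T x] polys_in_single[of 0 n 1]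
  by (simp_all add: monomial_op_trivial)

section \<open>Invertibility of polynomials without zeros on a spectral set\<close>

lemma op_norm_onD:
  assumes "op_norm_on M A \<le> ereal C" "x \<in> M" "norm x \<le> 1"
  shows "norm (A x) \<le> C"
proof -
  have "ereal (norm (A x)) \<le> op_norm_on M A"
    unfolding op_norm_on_def using assms by (intro SUP_upper) auto
  then show ?thesis using assms(1) by (metis ereal_less_eq(3) order_trans)
qed

text \<open>The inverse under \<^const>\<open>inv_into\<close> is eliminated by evaluating the rational function at
  \<open>q(T) y\<close>.\<close>

lemma spectral_set_rational_bound:
  assumes K: "spectral_set_on UNIV n K T" and p: "p \<in> polys_in n" and q: "q \<in> polys_in n"
    and q0: "\<And>z. z \<in> K \<Longrightarrow> poly_at n q z \<noteq> 0" and bij: "bij (poly_op n q T)"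
    and C: "\<And>z. z \<in> K \<Longrightarrow> cmod (poly_at n p z / poly_at n q z) \<le> C"
  shows "norm (poly_op n p T y) \<le> C * norm (poly_op n q T y)"
proof -
  have T: "commuting_tuple_on UNIV n T" using K by (simp add: spectral_set_on_def)
  note bp = bounded_op_poly[OF T, of p] and bq = bounded_op_poly[OF T, of q]
  define x where "x = poly_op n q T y"
  show ?thesis
  proof (cases "x = 0")
    case True
    then have "poly_op n q T y = poly_op n q T 0" by (simp add: x_def op_zero[OF bq])
    then have "y = 0" using bij by (meson bij_is_inj injD)
    then show ?thesis by (simp add: op_zero[OF bp] op_zero[OF bq])
  next
    case False
    define r where "r = complex_of_real (1 / norm x)"
    have "op_norm_on UNIV (rational_op_on UNIV n p q T)
        \<le> (SUP z\<in>K. ereal (cmod (poly_at n p z / poly_at n q z)))"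
      using K p q q0 by (simp add: spectral_set_on_def)
    also have "\<dots> \<le> ereal C" using C by (intro SUP_least) simp
    finally have "norm (rational_op_on UNIV n p q T (r *\<^sub>C x)) \<le> C"
      by (rule op_norm_onD) (use False in \<open>auto simp: norm_scaleC r_def norm_divide\<close>)
    moreover have "inv_into UNIV (poly_op n q T) (r *\<^sub>C x) = r *\<^sub>C y"
      using bij_is_inj[OF bij] by (intro inv_into_f_eq) (auto simp: op_scaleC[OF bq] x_def)
    ultimately have "norm (poly_op n p T y) / norm x \<le> C"
      by (simp add: rational_op_on_def op_scaleC[OF bp] norm_scaleC r_def norm_divide)
    then show ?thesis using False by (simp add: x_def divide_le_eq)
  qed
qed

corollary spectral_set_poly_bound:
  assumes "spectral_set_on UNIV n K T" "p \<in> polys_in n" "\<And>z. z \<in> K \<Longrightarrow> cmod (poly_at n p z) \<le> C"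
  shows "norm (poly_op n p T y) \<le> C * norm y"
proof -
  have "poly_op n 1 T = id" by (auto simp: poly_op_one)
  then show ?thesis
    using spectral_set_rational_bound[OF assms(1,2) one_in, of C y] assms(3)
    by (simp add: poly_at_one)
qed

text \<open>A perturbation of \<open>A\<close> that is small against \<open>A\<^sup>-\<^sup>1\<close> is still onto: \<open>B x = y\<close> is the fixed
  point equation of the strict contraction \<open>x \<mapsto> A\<^sup>-\<^sup>1 (y + A x - B x)\<close>.\<close>

lemma bij_perturbation:
  assumes A: "bounded_op_on UNIV A" and B: "bounded_op_on UNIV B" and bij: "bij A"
    and c: "\<And>y. norm y \<le> c * norm (A y)" and e: "\<And>y. norm (A y - B y) \<le> e * norm y"
    and ce: "0 \<le> c" "0 \<le> e" "c * e < 1"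
  shows "bij B"
proof (rule bijI)
  show "inj B"
  proof (rule injI)
    fix x y assume "B x = B y"
    then have "norm (A (x - y)) \<le> e * norm (x - y)"
      using e[of "x - y"] by (simp add: op_diff[OF B])
    then have "norm (x - y) \<le> (c * e) * norm (x - y)"
      using order_trans[OF c[of "x - y"] mult_left_mono[OF _ ce(1)]] by (simp add: mult.assoc)
    then have "(1 - c * e) * norm (x - y) \<le> 0" by (simp add: algebra_simps)
    then show "x = y" using ce(3) by (simp add: mult_le_0_iff)
  qed
  show "surj B"
  proof (rule surjI)
    fix y
    define f where "f x = inv A (y + (A x - B x))" for x
    have Af: "A (f x) = y + (A x - B x)" for x
      unfolding f_def by (rule surj_f_inv_f[OF bij_is_surj[OF bij]])
    have "dist (f x) (f z) \<le> (c * e) * dist x z" for x z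
    proof -
      have "A (f x - f z) = A (x - z) - B (x - z)"
        by (simp add: op_diff[OF A] op_diff[OF B] Af)
      then have "norm (f x - f z) \<le> c * (e * norm (x - z))"
        using c[of "f x - f z"] mult_left_mono[OF e[of "x - z"] ce(1)] by simp
      then show ?thesis by (simp add: dist_norm mult.assoc)
    qed
    then have "\<exists>!x. x \<in> UNIV \<and> f x = x"
      using Banach_fix[of "UNIV::'a set" "c * e" f] ce by (auto simp: complete_UNIV)
    then obtain x where "f x = x" by blast
    then have "B x = y" using Af[of x] by simp
    then show "B (inv B y) = y" by (rule f_inv_into_f[OF range_eqI[OF sym]])
  qed
qed

text \<open>The polynomial \<open>z \<mapsto> q (t z\<^sub>1, t\<^sup>2 z\<^sub>2, \<dots>, t\<^sup>n z\<^sub>n)\<close>.\<close>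

definition weight :: "nat \<Rightarrow> (nat \<Rightarrow>\<^sub>0 nat) \<Rightarrow> nat" where
  "weight n m = (\<Sum>i\<in>{1..n}. i * Poly_Mapping.lookup m i)"

definition dilated_poly :: "nat \<Rightarrow> real \<Rightarrow> cmpoly \<Rightarrow> cmpoly" where
  "dilated_poly n t q = Poly_Mapping.mapp (\<lambda>m c. c * complex_of_real t ^ weight n m) q"

lemma lookup_dilated:
  "Poly_Mapping.lookup (dilated_poly n t q) m = Poly_Mapping.lookup q m * complex_of_real t ^ weight n m"
  by (simp add: dilated_poly_def lookup_mapp when_def in_keys_iff)

lemma keys_dilated: "Poly_Mapping.keys (dilated_poly n t q) \<subseteq> Poly_Mapping.keys q"
  unfolding dilated_poly_def by (rule keys_mapp_subset)

lemma poly_op_dilated: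
  "poly_op n (dilated_poly n t q) T x =
    (\<Sum>m\<in>Poly_Mapping.keys q.
      (Poly_Mapping.lookup q m * complex_of_real t ^ weight n m) *\<^sub>C monomial_op n m T x)"
  by (subst poly_op_superset[OF finite_keys keys_dilated]) (simp add: lookup_dilated)

lemma poly_at_dilated:
  "poly_at n (dilated_poly n t q) z = poly_at n q (\<lambda>i\<in>{1..n}. complex_of_real t ^ i * z i)"
proof -
  have "complex_of_real t ^ weight n m * (\<Prod>i\<in>{1..n}. z i ^ Poly_Mapping.lookup m i)
      = (\<Prod>i\<in>{1..n}. (\<lambda>i\<in>{1..n}. complex_of_real t ^ i * z i) i ^ Poly_Mapping.lookup m i)" for m
    by (simp add: weight_def power_sum power_mult power_mult_distrib flip: prod.distrib)
  then show ?thesis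
    by (subst poly_at_superset[OF finite_keys keys_dilated])
      (simp add: lookup_dilated poly_at_def mult.assoc)
qed

lemma poly_op_dilated_lipschitz:
  assumes T: "commuting_tuple_on UNIV n T"
  obtains L where "L \<ge> 0" "\<And>t s x. t \<in> {0..1} \<Longrightarrow> s \<in> {0..1} \<Longrightarrow>
    norm (poly_op n (dilated_poly n t q) T x - poly_op n (dilated_poly n s q) T x) \<le> L * \<bar>t - s\<bar> * norm x"
proof -
  have "\<exists>B. B \<ge> 0 \<and> (\<forall>x. norm (monomial_op n m T x) \<le> B * norm x)" for m
    using bounded_op_bound[OF bounded_op_monomial[OF T]] by metis
  then obtain B where B: "\<And>m. B m \<ge> 0" "\<And>m x. norm (monomial_op n m T x) \<le> B m * norm x" by metis
  define L where "L = (\<Sum>m\<in>Poly_Mapping.keys q. cmod (Poly_Mapping.lookup q m) * weight n m * B m)"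
  have "norm (poly_op n (dilated_poly n t q) T x - poly_op n (dilated_poly n s q) T x)
      \<le> L * \<bar>t - s\<bar> * norm x" if ts: "t \<in> {0..1}" "s \<in> {0..1}" for t s x
  proof -
    have "norm (poly_op n (dilated_poly n t q) T x - poly_op n (dilated_poly n s q) T x)
        = norm (\<Sum>m\<in>Poly_Mapping.keys q. (Poly_Mapping.lookup q m *
            (complex_of_real t ^ weight n m - complex_of_real s ^ weight n m)) *\<^sub>C monomial_op n m T x)"
      unfolding poly_op_dilated sum_subtractf [symmetric]
      by (simp add: right_diff_distrib scaleC_diff_left)
    also have "\<dots> \<le> (\<Sum>m\<in>Poly_Mapping.keys q.
        cmod (Poly_Mapping.lookup q m) * (weight n m * \<bar>t - s\<bar>) * (B m * norm x))"
    proof (intro order_trans[OF norm_sum] sum_mono)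
      fix m
      have "cmod (complex_of_real t ^ weight n m - complex_of_real s ^ weight n m)
          \<le> weight n m * cmod (complex_of_real t - complex_of_real s)"
        using ts by (intro norm_power_diff) auto
      then have "cmod (complex_of_real t ^ weight n m - complex_of_real s ^ weight n m)
          \<le> weight n m * \<bar>t - s\<bar>"
        by (simp flip: of_real_diff)
      then show "norm ((Poly_Mapping.lookup q m *
            (complex_of_real t ^ weight n m - complex_of_real s ^ weight n m)) *\<^sub>C monomial_op n m T x)
          \<le> cmod (Poly_Mapping.lookup q m) * (weight n m * \<bar>t - s\<bar>) * (B m * norm x)"
        unfolding norm_scaleC norm_mult by (intro mult_mono B) auto
    qed
    also have "\<dots> = L * \<bar>t - s\<bar> * norm x"
      unfolding L_def sum_distrib_right by (intro sum.cong refl) (simp add: mult_ac)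
    finally show ?thesis .
  qed
  moreover have "L \<ge> 0" unfolding L_def using B(1) by (intro sum_nonneg) auto
  ultimately show thesis by (rule that[rotated])
qed

lemma poly_op_dilated_0:
  "poly_op n (dilated_poly n 0 q) T x = poly_at n (dilated_poly n 0 q) z *\<^sub>C x"
proof -
  have *: "(c * 0 ^ weight n m) *\<^sub>C monomial_op n m T x
      = (c * 0 ^ weight n m * (\<Prod>i\<in>{1..n}. z i ^ Poly_Mapping.lookup m i)) *\<^sub>C x" for m and c :: complex
  proof (cases "weight n m = 0")
    case True
    then have "Poly_Mapping.lookup m i = 0" if "i \<in> {1..n}" for i
      using that by (auto simp: weight_def)
    then have "monomial_op n m T x = x" "(\<Prod>i\<in>{1..n}. z i ^ Poly_Mapping.lookup m i) = 1"
      by (auto intro: monomial_op_trivial prod.neutral)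
    then show ?thesis by simp
  next
    case False
    then have "(0::complex) ^ weight n m = 0" by simp
    then show ?thesis by (simp only: mult_zero_left mult_zero_right scaleC_zero_left)
  qed
  show ?thesis
    by (subst poly_at_superset[OF finite_keys keys_dilated])
      (simp add: poly_op_dilated lookup_dilated * scaleC_sum_left)
qed

lemma poly_at_bounded_below:
  assumes K: "compact K" and nz: "\<And>z. z \<in> K \<Longrightarrow> poly_at n q z \<noteq> 0"
  obtains d where "d > 0" "\<And>z. z \<in> K \<Longrightarrow> cmod (poly_at n q z) \<ge> d"
proof (cases "K = {}")
  case True
  then show thesis by (intro that[of 1]) auto
next
  case False
  have "continuous_on K (\<lambda>z. cmod (poly_at n q z))"
    unfolding poly_at_def
    by (intro continuous_intros continuous_on_subset[OF continuous_on_product_coordinates]) auto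
  then obtain w where "w \<in> K" "\<And>z. z \<in> K \<Longrightarrow> cmod (poly_at n q w) \<le> cmod (poly_at n q z)"
    using continuous_attains_inf[OF K False] by blast
  then show thesis using nz by (intro that[of "cmod (poly_at n q w)"]) auto
qed

text \<open>The dilated polynomials \<open>q\<^sub>t\<close> join a nonzero constant to \<open>q\<close>, and none of them vanishes on
  \<open>K\<close>. Wherever \<open>q\<^sub>t(T)\<close> is invertible, the norm of the inverse is at most
  \<open>1 / min\<^bsub>K\<^esub> \<bar>q\<bar>\<close>, because \<open>K\<close> is a spectral set. This bound does not depend on \<open>t\<close>, so
  invertibility propagates from \<open>t = 0\<close> to \<open>t = 1\<close> in finitely many steps of equal length.\<close>

theorem poly_op_bij:
  assumes K: "spectral_set_on UNIV n K T" and ne: "K \<noteq> {}"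
    and dil: "\<And>t z. t \<in> {0..1} \<Longrightarrow> z \<in> K \<Longrightarrow> (\<lambda>i\<in>{1..n}. complex_of_real t ^ i * z i) \<in> K"
    and q: "q \<in> polys_in n" and nz: "\<And>z. z \<in> K \<Longrightarrow> poly_at n q z \<noteq> 0"
  shows "bij (poly_op n q T)"
proof -
  have T: "commuting_tuple_on UNIV n T" and cK: "compact K" using K by (auto simp: spectral_set_on_def)
  obtain d where d: "d > 0" "\<And>z. z \<in> K \<Longrightarrow> cmod (poly_at n q z) \<ge> d"
    using poly_at_bounded_below[OF cK nz] by blast
  obtain L where L: "L \<ge> 0" "\<And>t s x. t \<in> {0..1} \<Longrightarrow> s \<in> {0..1} \<Longrightarrow>
    norm (poly_op n (dilated_poly n t q) T x - poly_op n (dilated_poly n s q) T x) \<le> L * \<bar>t - s\<bar> * norm x"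
    using poly_op_dilated_lipschitz[OF T] by blast
  have below: "cmod (poly_at n (dilated_poly n t q) z) \<ge> d" if "t \<in> {0..1}" "z \<in> K" for t z
    unfolding poly_at_dilated by (intro d(2) dil that)
  have step: "bij (poly_op n (dilated_poly n s q) T)"
    if ts: "t \<in> {0..1}" "s \<in> {0..1}" "L * \<bar>t - s\<bar> < d" and bij: "bij (poly_op n (dilated_poly n t q) T)" for t s
  proof (rule bij_perturbation[OF bounded_op_poly[OF T] bounded_op_poly[OF T] bij])
    fix y
    have "norm (poly_op n 1 T y)
        \<le> (1 / d) * norm (poly_op n (dilated_poly n t q) T y)"
    proof (rule spectral_set_rational_bound[OF K one_in _ _ bij])
      show "dilated_poly n t q \<in> polys_in n"
        using q keys_dilated[of n t q] unfolding polys_in_def by blast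
      fix z assume z: "z \<in> K"
      show "poly_at n (dilated_poly n t q) z \<noteq> 0" using below[OF ts(1) z] d(1) by auto
      show "cmod (poly_at n 1 z / poly_at n (dilated_poly n t q) z) \<le> 1 / d"
        using below[OF ts(1) z] d(1) unfolding poly_at_one norm_divide norm_one by (intro frac_le) auto
    qed
    then show "norm y \<le> (1 / d) * norm (poly_op n (dilated_poly n t q) T y)"
      by (simp add: poly_op_one)
    show "norm (poly_op n (dilated_poly n t q) T y - poly_op n (dilated_poly n s q) T y)
        \<le> (L * \<bar>t - s\<bar>) * norm y" by (rule L(2)[OF ts(1,2)])
  qed (use L d ts in auto)
  obtain N :: nat where "L / d < N" using reals_Archimedean2 by blast
  have N: "N > 0" "L / N < d"
  proof -
    show "N > 0" using \<open>L / d < N\<close> L(1) d(1) by (intro gr0I) (auto simp: divide_less_0_iff)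
    then show "L / N < d" using \<open>L / d < N\<close> d(1) by (simp add: field_simps)
  qed
  have "bij (poly_op n (dilated_poly n (k / N) q) T)" if "k \<le> N" for k
    using that
  proof (induction k)
    case 0
    \<comment> \<open>At \<open>t = 0\<close> the polynomial is constant, so any point of \<open>K\<close> gives its value.\<close>
    obtain z where z: "z \<in> K" using ne by blast
    define c where "c = poly_at n (dilated_poly n 0 q) z"
    have c: "c \<noteq> 0" using below[of 0 z] z d(1) by (auto simp: c_def)
    have "poly_op n (dilated_poly n 0 q) T = (\<lambda>x. c *\<^sub>C x)"
      unfolding c_def by (rule ext) (rule poly_op_dilated_0)
    moreover have "bij (\<lambda>x::'a. c *\<^sub>C x)"
      using c by (intro o_bij[of "\<lambda>x. inverse c *\<^sub>C x"]) (auto simp: scaleC_scaleC)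
    ultimately show ?case by simp
  next
    case (Suc k)
    have diff: "\<bar>real k / N - real (Suc k) / N\<bar> = 1 / N"
      by (simp add: diff_divide_distrib [symmetric])
    show ?case
    proof (rule step)
      show "real k / N \<in> {0..1}" "real (Suc k) / N \<in> {0..1}"
        using Suc.prems N(1) by (auto simp: divide_le_eq)
      show "L * \<bar>real k / N - real (Suc k) / N\<bar> < d" unfolding diff using N(2) by simp
      show "bij (poly_op n (dilated_poly n (k / N) q) T)" using Suc by simp
    qed
  qed
  from this[of N] have "bij (poly_op n (dilated_poly n 1 q) T)" using N by simp
  moreover have "poly_op n (dilated_poly n 1 q) T = poly_op n q T"
    by (rule ext) (simp only: poly_op_dilated, simp add: poly_op_def)
  ultimately show ?thesis by simp
qed

section \<open>The symmetrized polydisc\<close>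

text \<open>The classical maximum principle is applied to one coordinate at a time.\<close>

lemma maximum_principle_polydisc:
  fixes f :: "('i \<Rightarrow> complex) \<Rightarrow> complex"
  assumes fin: "finite I" and hol: "\<And>z j. j \<in> I \<Longrightarrow> (\<lambda>w. f (z(j := w))) holomorphic_on UNIV"
    and bound: "\<And>z. z \<in> I \<rightarrow>\<^sub>E sphere 0 1 \<Longrightarrow> cmod (f z) \<le> C" and z: "z \<in> I \<rightarrow>\<^sub>E cball 0 1"
  shows "cmod (f z) \<le> C"
proof -
  have "cmod (f z) \<le> C" if "F \<subseteq> I" "z \<in> (\<Pi>\<^sub>E i\<in>I. if i \<in> F then cball 0 1 else sphere 0 1)" for F z
    using finite_subset[OF that(1) fin] that
  proof (induction F arbitrary: z rule: finite_induct)
    case empty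
    then show ?case by (intro bound) simp
  next
    case (insert j F)
    define g where "g w = f (z(j := w))" for w
    have hg: "g holomorphic_on UNIV" unfolding g_def using hol insert.prems(1) by blast
    have jI: "j \<in> I" using insert.prems(1) by simp
    have "cmod (g (z j)) \<le> C"
    proof (rule maximum_modulus_frontier[of g "cball 0 1"])
      show "g holomorphic_on interior (cball 0 1)" using hg holomorphic_on_subset by blast
      show "continuous_on (closure (cball 0 1)) g"
        using holomorphic_on_imp_continuous_on[OF hg] continuous_on_subset by blast
      show "z j \<in> cball 0 1" using PiE_mem[OF insert.prems(2) jI] by simp
      fix w :: complex assume "w \<in> frontier (cball 0 1)"
      then have w: "w \<in> sphere 0 1" by simp
      have "z(j := w) \<in> (\<Pi>\<^sub>E i\<in>I. if i \<in> F then cball 0 1 else sphere 0 1)"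
      proof (rule PiE_I)
        fix i assume i: "i \<in> I"
        show "(z(j := w)) i \<in> (if i \<in> F then cball 0 1 else sphere 0 1)"
          using PiE_mem[OF insert.prems(2) i] w insert.hyps(2) by (cases "i = j") auto
      next
        fix i assume "i \<notin> I"
        then show "(z(j := w)) i = undefined" using PiE_arb[OF insert.prems(2)] jI by auto
      qed
      then show "cmod (g w) \<le> C" unfolding g_def using insert.prems(1) by (intro insert.IH) auto
    qed simp
    then show ?case by (simp add: g_def)
  qed
  from this[of I z] show ?thesis using z by (simp cong: PiE_cong)
qed

lemma sym_map_eq: "k \<in> {1..n} \<Longrightarrow> sym_map n z k = (\<Sum>I | I \<subseteq> {1..n} \<and> card I = k. \<Prod>i\<in>I. z i)"
  by (simp add: sym_map_def)

lemma sym_map_last: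
  assumes "n \<ge> 1"
  shows "sym_map n z n = (\<Prod>i\<in>{1..n}. z i)"
proof -
  have "{I. I \<subseteq> {1..n} \<and> card I = n} = {{1..n}}"
    using card_subset_eq[of "{1..n}"] by auto
  then show ?thesis using assms by (simp add: sym_map_eq)
qed

lemma holomorphic_sym_map:
  assumes "k \<in> {1..n}"
  shows "(\<lambda>w. sym_map n (z(j := w)) k) holomorphic_on UNIV"
proof -
  have "(\<lambda>w. (z(j := w)) i) holomorphic_on UNIV" for i
    by (cases "i = j") (auto intro: holomorphic_intros)
  then show ?thesis unfolding sym_map_eq[OF assms] by (intro holomorphic_intros)
qed

text \<open>On the torus \<open>cnj z\<^sub>i = 1 / z\<^sub>i\<close>, so conjugating an elementary symmetric polynomial and
  multiplying by the product of all the coordinates complements the index sets.\<close>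

lemma sym_map_torus:
  assumes z: "z \<in> {1..n} \<rightarrow>\<^sub>E sphere 0 1" and i: "i \<in> {1..n - 1}"
  shows "sym_map n z (n - i) = sym_map n z n * cnj (sym_map n z i)"
proof -
  have z1: "z j * cnj (z j) = 1" if "j \<in> {1..n}" for j
    using PiE_mem[OF z that] by (simp flip: complex_norm_square)
  have n: "n \<ge> 1" "i \<in> {1..n}" "n - i \<in> {1..n}" using i by auto
  have "sym_map n z n * cnj (sym_map n z i)
      = (\<Sum>I | I \<subseteq> {1..n} \<and> card I = i. (\<Prod>j\<in>{1..n}. z j) * (\<Prod>j\<in>I. cnj (z j)))"
    by (simp add: sym_map_last[OF n(1)] sym_map_eq[OF n(2)] sum_distrib_left)
  also have "\<dots> = (\<Sum>I | I \<subseteq> {1..n} \<and> card I = i. \<Prod>j\<in>{1..n} - I. z j)"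
  proof (intro sum.cong refl)
    fix I assume I: "I \<in> {I. I \<subseteq> {1..n} \<and> card I = i}"
    then have "(\<Prod>j\<in>{1..n}. z j) = (\<Prod>j\<in>{1..n} - I. z j) * (\<Prod>j\<in>I. z j)"
      by (intro prod.subset_diff) auto
    moreover have "(\<Prod>j\<in>I. z j) * (\<Prod>j\<in>I. cnj (z j)) = 1"
      unfolding prod.distrib [symmetric] using I z1 by (intro prod.neutral) auto
    ultimately show "(\<Prod>j\<in>{1..n}. z j) * (\<Prod>j\<in>I. cnj (z j)) = (\<Prod>j\<in>{1..n} - I. z j)"
      by (simp add: mult.assoc)
  qed
  also have "\<dots> = (\<Sum>I | I \<subseteq> {1..n} \<and> card I = n - i. \<Prod>j\<in>I. z j)"
  proof (rule sum.reindex_bij_witness[where i = "\<lambda>I. {1..n} - I" and j = "\<lambda>I. {1..n} - I"])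
    fix I :: "nat set" assume "I \<in> {I. I \<subseteq> {1..n} \<and> card I = i}"
    then show "{1..n} - I \<in> {I. I \<subseteq> {1..n} \<and> card I = n - i}"
      by (auto simp: card_Diff_subset finite_subset)
  next
    fix I :: "nat set" assume "I \<in> {I. I \<subseteq> {1..n} \<and> card I = n - i}"
    then show "{1..n} - I \<in> {I. I \<subseteq> {1..n} \<and> card I = i}"
      using n by (auto simp: card_Diff_subset finite_subset)
  qed (auto simp: double_diff)
  finally show ?thesis using sym_map_eq[OF n(3), of z] by simp
qed

lemma norm_prod_polydisc_le:
  fixes j n :: nat
  assumes z: "z \<in> {1..n} \<rightarrow>\<^sub>E cball 0 1" and j: "j \<in> {1..n}"
  shows "cmod (\<Prod>i\<in>{1..n}. z i) \<le> cmod (z j)"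
proof -
  have "cmod (\<Prod>i\<in>{1..n} - {j}. z i) \<le> 1"
    unfolding prod_norm [symmetric] using PiE_mem[OF z] by (intro prod_le_1) auto
  then have "cmod (z j) * cmod (\<Prod>i\<in>{1..n} - {j}. z i) \<le> cmod (z j)"
    by (simp add: mult_left_le)
  moreover have "(\<Prod>i\<in>{1..n}. z i) = z j * (\<Prod>i\<in>{1..n} - {j}. z i)"
    using j by (intro prod.remove) auto
  ultimately show ?thesis by (simp only: norm_mult)
qed

text \<open>The last coordinate of a point of the symmetrized polydisc is a product of numbers of
  modulus at most one. It is unimodular only if all the factors are.\<close>

lemma sym_polydisc_last:
  assumes n: "n \<ge> 1" and s: "s \<in> sym_polydisc n"
  shows norm_last_le_1: "cmod (s n) \<le> 1" and in_sym_torus: "cmod (s n) \<ge> 1 \<Longrightarrow> s \<in> sym_torus n"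
proof -
  obtain z where z: "z \<in> {1..n} \<rightarrow>\<^sub>E cball 0 1" "s = sym_map n z"
    using s by (auto simp: sym_polydisc_def)
  have sn: "s n = (\<Prod>i\<in>{1..n}. z i)" by (simp add: z(2) sym_map_last[OF n])
  have z1: "cmod (z j) \<le> 1" if "j \<in> {1..n}" for j using PiE_mem[OF z(1) that] by simp
  have le: "cmod (s n) \<le> cmod (z j)" if "j \<in> {1..n}" for j
    unfolding sn by (rule norm_prod_polydisc_le[OF z(1) that])
  show "cmod (s n) \<le> 1" using le[of n] z1[of n] n by simp
  show "s \<in> sym_torus n" if "cmod (s n) \<ge> 1"
  proof -
    have "z \<in> {1..n} \<rightarrow>\<^sub>E sphere 0 1"
    proof (rule PiE_I)
      fix j assume j: "j \<in> {1..n}"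
      show "z j \<in> sphere 0 1" using le[OF j] z1[OF j] that by simp
    qed (rule PiE_arb[OF z(1)])
    then show ?thesis by (auto simp: sym_torus_def z(2))
  qed
qed

lemma sym_polydisc_nonempty: "sym_polydisc n \<noteq> {}"
proof -
  have "(\<lambda>i\<in>{1..n}. 0) \<in> {1..n} \<rightarrow>\<^sub>E cball (0::complex) 1" by simp
  then show ?thesis unfolding sym_polydisc_def by blast
qed

lemma sym_polydisc_dilation:
  assumes t: "t \<in> {0..1}" and s: "s \<in> sym_polydisc n"
  shows "(\<lambda>i\<in>{1..n}. complex_of_real t ^ i * s i) \<in> sym_polydisc n"
proof -
  obtain z where z: "z \<in> {1..n} \<rightarrow>\<^sub>E cball 0 1" "s = sym_map n z"
    using s by (auto simp: sym_polydisc_def)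
  define w where "w = (\<lambda>i\<in>{1..n}. complex_of_real t * z i)"
  have "w \<in> {1..n} \<rightarrow>\<^sub>E cball 0 1"
  proof (rule PiE_I)
    fix j assume j: "j \<in> {1..n}"
    then have "cmod (z j) \<le> 1" using PiE_mem[OF z(1) j] by simp
    then have "t * cmod (z j) \<le> 1 * 1" using t by (intro mult_mono) auto
    then show "w j \<in> cball 0 1" using j t by (simp add: w_def norm_mult)
  qed (auto simp: w_def)
  moreover have "(\<lambda>i\<in>{1..n}. complex_of_real t ^ i * s i) = sym_map n w"
  proof
    fix k
    show "(\<lambda>i\<in>{1..n}. complex_of_real t ^ i * s i) k = sym_map n w k"
    proof (cases "k \<in> {1..n}")
      case True
      have "(\<Prod>i\<in>I. w i) = complex_of_real t ^ k * (\<Prod>i\<in>I. z i)" if "I \<subseteq> {1..n} \<and> card I = k" for I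
      proof -
        have "(\<Prod>i\<in>I. w i) = (\<Prod>i\<in>I. complex_of_real t * z i)"
          using that by (intro prod.cong) (auto simp: w_def subset_iff)
        then show ?thesis using that by (simp add: prod.distrib)
      qed
      then show ?thesis using True by (simp add: z(2) sym_map_eq sum_distrib_left)
    qed (auto simp: sym_map_def)
  qed
  ultimately show ?thesis unfolding sym_polydisc_def by blast
qed

text \<open>On the torus \<open>b = cnj (a s\<^sub>i)\<close> turns \<open>s\<^sub>n\<^sub>-\<^sub>i\<close> into the product of \<open>p\<close> and a conjugate, and the
  polynomial becomes \<open>p (2 Re (a s\<^sub>i) + \<i> t)\<close>.\<close>

lemma quad_poly_bound:
  assumes i: "i \<in> {1..n - 1}" and a: "cmod a = 1"
  obtains C where "\<And>t s. s \<in> sym_polydisc n \<Longrightarrow>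
    cmod (poly_at n (quad_poly n i a (cnj a) (\<i> * complex_of_real t)) s) \<le> sqrt (C + t\<^sup>2)"
proof -
  define D where "D = real (card {I. I \<subseteq> {1..n} \<and> card I = i})"
  have n: "n \<ge> 1" "n \<in> {1..n}" "i \<in> {1..n}" "n - i \<in> {1..n}" using i by auto
  have shifted: "cmod (complex_of_real (2 * r) + \<i> * complex_of_real t) = sqrt (4 * r\<^sup>2 + t\<^sup>2)" for r t
    by (simp add: cmod_def power_mult_distrib)
  have torus: "cmod (a * (sym_map n z i * sym_map n z n) + cnj a * sym_map n z (n - i)
      + \<i> * complex_of_real t * sym_map n z n) \<le> sqrt (4 * D\<^sup>2 + t\<^sup>2)"
    if z: "z \<in> {1..n} \<rightarrow>\<^sub>E sphere 0 1" for z t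
  proof -
    have z1: "cmod (z j) = 1" if "j \<in> {1..n}" for j using PiE_mem[OF z that] by simp
    have p: "cmod (sym_map n z n) = 1"
      unfolding sym_map_last[OF n(1)] prod_norm [symmetric] using z1 by (intro prod.neutral) auto
    have "cmod (sym_map n z i) \<le> (\<Sum>I | I \<subseteq> {1..n} \<and> card I = i. cmod (\<Prod>j\<in>I. z j))"
      unfolding sym_map_eq[OF n(3)] by (rule norm_sum)
    also have "\<dots> = (\<Sum>I | I \<subseteq> {1..n} \<and> card I = i. 1)"
      unfolding prod_norm [symmetric] using z1 by (intro sum.cong refl prod.neutral) auto
    finally have "cmod (a * sym_map n z i) \<le> D" using a by (simp add: D_def norm_mult)
    then have "\<bar>Re (a * sym_map n z i)\<bar> \<le> D" using abs_Re_le_cmod order_trans by blast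
    then have "(Re (a * sym_map n z i))\<^sup>2 \<le> D\<^sup>2" by (rule abs_le_square_iff[THEN iffD1, OF order_trans[OF _ abs_ge_self]])
    then have *: "cmod (complex_of_real (2 * Re (a * sym_map n z i)) + \<i> * complex_of_real t)
        \<le> sqrt (4 * D\<^sup>2 + t\<^sup>2)" unfolding shifted by simp
    have "a * (sym_map n z i * sym_map n z n) + cnj a * sym_map n z (n - i)
        + \<i> * complex_of_real t * sym_map n z n
        = sym_map n z n * (a * sym_map n z i + cnj (a * sym_map n z i) + \<i> * complex_of_real t)"
      by (simp add: sym_map_torus[OF z i] algebra_simps)
    then show ?thesis using * by (simp only: complex_add_cnj norm_mult p)
  qed
  have "cmod (poly_at n (quad_poly n i a (cnj a) (\<i> * complex_of_real t)) s) \<le> sqrt (4 * D\<^sup>2 + t\<^sup>2)"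
    if s: "s \<in> sym_polydisc n" for s t
  proof -
    obtain z where z: "z \<in> {1..n} \<rightarrow>\<^sub>E cball 0 1" "s = sym_map n z"
      using s by (auto simp: sym_polydisc_def)
    define f where "f z = a * (sym_map n z i * sym_map n z n) + cnj a * sym_map n z (n - i)
      + \<i> * complex_of_real t * sym_map n z n" for z
    have "cmod (f z) \<le> sqrt (4 * D\<^sup>2 + t\<^sup>2)"
    proof (rule maximum_principle_polydisc[OF _ _ _ z(1)])
      show "(\<lambda>w. f (z(j := w))) holomorphic_on UNIV" for z j
        unfolding f_def by (intro holomorphic_intros holomorphic_sym_map n)
      show "cmod (f z) \<le> sqrt (4 * D\<^sup>2 + t\<^sup>2)" if "z \<in> {1..n} \<rightarrow>\<^sub>E sphere 0 1" for z
        unfolding f_def by (rule torus[OF that])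
    qed simp
    then show ?thesis by (simp add: poly_at_quad[OF i] f_def z(2))
  qed
  then show thesis by (rule that)
qed

section \<open>Restriction to reducing subspaces\<close>

lemma reducesD:
  assumes "reduces M A" "x \<in> M"
  shows "A x \<in> M" "adjoint_on UNIV A x \<in> M"
  using assms by (auto simp: reduces_def)

lemma reduces_orth_complement_invariant:
  assumes "bounded_op_on UNIV A" "reduces M A" "x \<in> orth_complement M"
  shows "A x \<in> orth_complement M"
  by (rule orth_complement_invariant[OF adjoint_pair_adjoint[OF assms(1)] _ assms(3)])
    (rule reducesD[OF assms(2)])

lemma reduces_orth_complement:
  assumes A: "bounded_op_on UNIV A" and r: "reduces M A"
  shows "reduces (orth_complement M) A"
proof -
  have "adjoint_on UNIV A x \<in> orth_complement M" if "x \<in> orth_complement M" for x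
    by (rule orth_complement_invariant[OF adjoint_pair_sym[OF adjoint_pair_adjoint[OF A]] _ that])
      (rule reducesD[OF r])
  then show ?thesis
    using reduces_orth_complement_invariant[OF A r]
    by (auto simp: reduces_def closed_csubspace_orth_complement)
qed

lemma commuting_tuple_on_subspace:
  assumes T: "commuting_tuple_on UNIV n T" and M: "closed_csubspace M"
    and inv: "\<And>i x. i \<in> {1..n} \<Longrightarrow> x \<in> M \<Longrightarrow> T i x \<in> M"
  shows "commuting_tuple_on M n T"
proof -
  have "bounded_op_on M (T i)" if i: "i \<in> {1..n}" for i
    using tuple_bounded[OF T i] inv[OF i] by (auto simp: bounded_op_on_def)
  then show ?thesis using T M by (simp add: commuting_tuple_on_def)
qed

lemma
  assumes T: "commuting_tuple_on UNIV n T"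
  shows bounded_op_shift: "i \<in> {1..n} \<Longrightarrow> bounded_op_on UNIV (\<lambda>x. T i x - \<mu> i *\<^sub>C x)"
    and shift_commute: "i \<in> {1..n} \<Longrightarrow> j \<in> {1..n} \<Longrightarrow>
      T i (T j x - \<mu> j *\<^sub>C x) - \<mu> i *\<^sub>C (T j x - \<mu> j *\<^sub>C x)
      = T j (T i x - \<mu> i *\<^sub>C x) - \<mu> j *\<^sub>C (T i x - \<mu> i *\<^sub>C x)"
proof -
  show "bounded_op_on UNIV (\<lambda>x. T i x - \<mu> i *\<^sub>C x)" if "i \<in> {1..n}" for i
    using bounded_op_plus[OF tuple_bounded[OF T that] bounded_op_scaled[OF bounded_op_ident, of "- \<mu> i"]]
    by (simp add: scaleC_minus_left)
  show "T i (T j x - \<mu> j *\<^sub>C x) - \<mu> i *\<^sub>C (T j x - \<mu> j *\<^sub>C x)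
      = T j (T i x - \<mu> i *\<^sub>C x) - \<mu> j *\<^sub>C (T i x - \<mu> i *\<^sub>C x)" if ij: "i \<in> {1..n}" "j \<in> {1..n}" for i j
    using tuple_commute[OF T ij, of x]
    by (simp add: op_diff[OF tuple_bounded[OF T ij(1)]] op_scaleC[OF tuple_bounded[OF T ij(1)]]
        op_diff[OF tuple_bounded[OF T ij(2)]] op_scaleC[OF tuple_bounded[OF T ij(2)]]
        scaleC_diff_right scaleC_scaleC mult.commute algebra_simps)
qed

lemma taylor_spectrum_reducing:
  assumes T: "commuting_tuple_on UNIV n T" and M: "closed_csubspace M"
    and red: "\<And>i. i \<in> {1..n} \<Longrightarrow> reduces M (T i)"
  shows "taylor_spectrum M n T \<subseteq> taylor_spectrum UNIV n T"
proof -
  have "koszul_exact M n (\<lambda>i x. T i x - \<mu> i *\<^sub>C x)" if "koszul_exact UNIV n (\<lambda>i x. T i x - \<mu> i *\<^sub>C x)" for \<mu>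
  proof (rule koszul_exact_subspace[OF M _ _ _ that])
    fix i x assume i: "i \<in> {1..n}"
    show "bounded_op_on UNIV (\<lambda>x. T i x - \<mu> i *\<^sub>C x)" by (rule bounded_op_shift[OF T i])
    show "T i x - \<mu> i *\<^sub>C x \<in> M" if "x \<in> M"
      by (intro csubspace_diff csubspace_scaleC M that reducesD(1)[OF red[OF i]])
    show "T i x - \<mu> i *\<^sub>C x \<in> orth_complement M" if "x \<in> orth_complement M"
      by (intro csubspace_diff csubspace_scaleC closed_csubspace_orth_complement that
          reduces_orth_complement_invariant[OF tuple_bounded[OF T i] red[OF i]])
  qed
  then show ?thesis by (auto simp: taylor_spectrum_def)
qed

text \<open>As \<open>q(T)\<close> is a bijection of the whole space and leaves \<open>M\<close> and its complement invariant,
  its inverse on \<open>M\<close> is the restriction of its inverse.\<close>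

lemma spectral_set_on_reducing:
  assumes K: "spectral_set_on UNIV n K T" and ne: "K \<noteq> {}"
    and dil: "\<And>t z. t \<in> {0..1} \<Longrightarrow> z \<in> K \<Longrightarrow> (\<lambda>i\<in>{1..n}. complex_of_real t ^ i * z i) \<in> K"
    and M: "closed_csubspace M" and red: "\<And>i. i \<in> {1..n} \<Longrightarrow> reduces M (T i)"
  shows "spectral_set_on M n K T"
proof -
  have T: "commuting_tuple_on UNIV n T" using K by (simp add: spectral_set_on_def)
  have "op_norm_on M (rational_op_on M n p q T) \<le> (SUP z\<in>K. ereal (cmod (poly_at n p z / poly_at n q z)))"
    if p: "p \<in> polys_in n" and q: "q \<in> polys_in n" and nz: "\<And>z. z \<in> K \<Longrightarrow> poly_at n q z \<noteq> 0" for p q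
  proof -
    let ?q = "poly_op n q T"
    have bij: "bij ?q" by (rule poly_op_bij[OF K ne dil q nz])
    note lin = bounded_op_poly[OF T, of q]
    have inv: "inv_into M ?q x = inv_into UNIV ?q x" if x: "x \<in> M" for x
    proof -
      define y where "y = inv_into UNIV ?q x"
      have y: "?q y = x" unfolding y_def by (rule surj_f_inv_f[OF bij_is_surj[OF bij]])
      obtain u v where uv: "u \<in> M" "v \<in> orth_complement M" "y = u + v"
        using orthogonal_decomposition[OF M] by blast
      have "?q u \<in> M" by (rule poly_op_in[OF M reducesD(1)[OF red] uv(1)])
      moreover have "?q v \<in> orth_complement M"
        by (rule poly_op_in[OF closed_csubspace_orth_complement
              reduces_orth_complement_invariant[OF tuple_bounded[OF T] red] uv(2)])
      moreover have "?q v = x - ?q u" using y unfolding uv(3) op_add[OF lin] by (metis add_diff_cancel_left')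
      ultimately have "?q v = 0" using orth_complement_Int csubspace_diff[OF M x] by metis
      then have "?q v = ?q 0" by (simp add: op_zero[OF lin])
      then have "v = 0" by (rule injD[OF bij_is_inj[OF bij]])
      then have "y \<in> M" using uv by simp
      then show ?thesis
        using inv_into_f_eq[OF inj_on_subset[OF bij_is_inj[OF bij] subset_UNIV] _ y, of M]
        by (simp add: y_def)
    qed
    have "op_norm_on M (rational_op_on M n p q T) \<le> op_norm_on UNIV (rational_op_on UNIV n p q T)"
      unfolding op_norm_on_def
      by (rule SUP_mono) (auto simp: rational_op_on_def inv)
    also have "\<dots> \<le> (SUP z\<in>K. ereal (cmod (poly_at n p z / poly_at n q z)))"
      using K p q nz by (simp add: spectral_set_on_def)
    finally show ?thesis .
  qed
  moreover have "taylor_spectrum M n T \<subseteq> K"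
    by (rule order_trans[OF taylor_spectrum_reducing[OF T M red]])
      (use K in \<open>auto simp: spectral_set_on_def\<close>)
  moreover have "commuting_tuple_on M n T"
    by (rule commuting_tuple_on_subspace[OF T M reducesD(1)[OF red]])
  ultimately show ?thesis using K by (simp add: spectral_set_on_def)
qed

corollary gamma_contraction_on_reducing:
  assumes "gamma_contraction_on UNIV n T" "closed_csubspace M" "\<And>i. i \<in> {1..n} \<Longrightarrow> reduces M (T i)"
  shows "gamma_contraction_on M n T"
  unfolding gamma_contraction_on_def
  by (rule spectral_set_on_reducing[OF assms(1)[unfolded gamma_contraction_on_def]
        sym_polydisc_nonempty sym_polydisc_dilation assms(2,3)])

section \<open>The part on which the last operator is unitary\<close>

text \<open>The squares \<open>t\<^sup>2 r\<^sup>2\<close> on both sides cancel. What remains bounds a linear function of \<open>t\<close>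
  with slope \<open>2 r Im w\<close>.\<close>

lemma Im_eq_0_if_shifts_bounded:
  assumes r: "r \<ge> 0" and b: "\<And>t::real. cmod (w + \<i> * complex_of_real t * complex_of_real r) \<le> sqrt (C + t\<^sup>2) * r"
    and C: "C \<ge> 0"
  shows "Im w = 0"
proof (rule ccontr)
  assume w: "Im w \<noteq> 0"
  have *: "(Im w)\<^sup>2 + 2 * t * r * Im w \<le> C * r\<^sup>2" for t
  proof -
    have "(cmod (w + \<i> * complex_of_real t * complex_of_real r))\<^sup>2 \<le> (sqrt (C + t\<^sup>2) * r)\<^sup>2"
      by (intro power_mono b) simp
    then have "(Re w)\<^sup>2 + (Im w + t * r)\<^sup>2 \<le> (C + t\<^sup>2) * r\<^sup>2"
      using C by (simp add: cmod_power2 power_mult_distrib)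
    then have "(Im w + t * r)\<^sup>2 \<le> (C + t\<^sup>2) * r\<^sup>2"
      using zero_le_power2[of "Re w"] by linarith
    then show ?thesis by (simp add: power2_eq_square algebra_simps)
  qed
  show False
  proof (cases "r = 0")
    case True
    then show False using *[of 0] w by simp
  next
    case False
    define t where "t = (C * r\<^sup>2 + 1) / (2 * r * Im w)"
    have "2 * t * r * Im w = C * r\<^sup>2 + 1" using False w by (simp add: t_def)
    then show False using *[of t] zero_le_power2[of "Im w"] by linarith
  qed
qed

text \<open>Polarization: over the complex numbers the values at \<open>u + v\<close> and \<open>u + \<i> v\<close> recover the
  sesquilinear form.\<close>

lemma zero_if_quadratic_form_zero:
  fixes D :: "'a::complex_hilbert_space \<Rightarrow> 'a"
  assumes M: "closed_csubspace M" and D: "\<And>x. x \<in> M \<Longrightarrow> D x \<in> M"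
    and add: "\<And>x y. D (x + y) = D x + D y" and scale: "\<And>c x. D (c *\<^sub>C x) = c *\<^sub>C D x"
    and zero: "\<And>u. u \<in> M \<Longrightarrow> cinner (D u) u = 0" and u: "u \<in> M"
  shows "D u = 0"
proof -
  have "cinner (D u) v = 0" if v: "v \<in> M" for v
  proof -
    have "cinner (D u) v + cinner (D v) u = 0"
      using zero[OF csubspace_add[OF M u v]] zero[OF u] zero[OF v]
      by (simp add: add cinner_linear add.commute)
    moreover have "- \<i> * cinner (D u) v + \<i> * cinner (D v) u = 0"
      using zero[OF csubspace_add[OF M u csubspace_scaleC[OF M v, of \<i>]]] zero[OF u] zero[OF v]
      by (simp add: add scale cinner_linear)
    then have "cinner (D v) u = cinner (D u) v"
      by (metis add.commute add_eq_0_iff complex_i_not_zero minus_mult_left mult_cancel_left neg_equal_iff_equal)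
    ultimately show ?thesis by simp
  qed
  then show ?thesis using D[OF u] cinner_self_eq_0_iff by blast
qed

text \<open>Let \<open>Q\<close> be the inverse of \<open>P = T\<^sub>n\<close> on \<open>M\<close>. The spectral set inequality for
  \<open>a s\<^sub>i p + cnj a s\<^sub>n\<^sub>-\<^sub>i + \<i> t p\<close> bounds \<open>A + \<i> t\<close> by \<open>\<surd>(C + t\<^sup>2)\<close>, where
  \<open>A = a T\<^sub>i + cnj a T\<^sub>n\<^sub>-\<^sub>i Q\<close>, and this for all real \<open>t\<close>. So \<open>A\<close> has real numerical range. Taking
  \<open>a = 1\<close> and \<open>a = \<i>\<close> shows that \<open>T\<^sub>n\<^sub>-\<^sub>i Q\<close> and the adjoint of \<open>T\<^sub>i\<close> have the same quadratic form.\<close>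

theorem adjoint_eq_on_unitary_part:
  assumes G: "gamma_contraction_on UNIV n T" and i: "i \<in> {1..n - 1}" and M: "closed_csubspace M"
    and inv: "\<And>x. x \<in> M \<Longrightarrow> adjoint_on UNIV (T i) x \<in> M" "\<And>x. x \<in> M \<Longrightarrow> T (n - i) x \<in> M"
    and Q: "adjoint_pair (T n) Q" "\<And>x. x \<in> M \<Longrightarrow> Q x \<in> M" "\<And>x. x \<in> M \<Longrightarrow> T n (Q x) = x"
    and contr: "\<And>x. norm (Q x) \<le> norm x" and u: "u \<in> M"
  shows "adjoint_on UNIV (T i) u = T (n - i) (Q u)"
proof -
  have K: "spectral_set_on UNIV n (sym_polydisc n) T" using G by (simp add: gamma_contraction_on_def)
  then have T: "commuting_tuple_on UNIV n T" by (simp add: spectral_set_on_def)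
  have ii: "i \<in> {1..n}" "n - i \<in> {1..n}" using i by auto
  note bi = tuple_bounded[OF T ii(1)] and bni = tuple_bounded[OF T ii(2)]
  note adj = adjoint_pair_adjoint[OF bi]
  have real: "Im (a * cinner (T i u) u + cnj a * cinner (T (n - i) (Q u)) u) = 0"
    if a: "cmod a = 1" and u: "u \<in> M" for a u
  proof -
    obtain C where C: "\<And>t s. s \<in> sym_polydisc n \<Longrightarrow>
      cmod (poly_at n (quad_poly n i a (cnj a) (\<i> * complex_of_real t)) s) \<le> sqrt (C + t\<^sup>2)"
      using quad_poly_bound[OF i a] by blast
    define w where "w = cinner (a *\<^sub>C T i u + cnj a *\<^sub>C T (n - i) (Q u)) u"
    have "cmod (w + \<i> * complex_of_real t * complex_of_real ((norm u)\<^sup>2)) \<le> sqrt (max C 0 + t\<^sup>2) * (norm u)\<^sup>2" for t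
    proof -
      \<comment> \<open>The estimate is applied at \<open>Q u\<close>, which removes the factor \<open>p\<close> from the polynomial.\<close>
      let ?p = "quad_poly n i a (cnj a) (\<i> * complex_of_real t)"
      have "norm (poly_op n ?p T (Q u)) \<le> sqrt (C + t\<^sup>2) * norm (Q u)"
        by (rule spectral_set_poly_bound[OF K quad_poly_in[OF i] C])
      also have "\<dots> \<le> sqrt (max C 0 + t\<^sup>2) * norm u" by (intro mult_mono contr) auto
      finally have "norm (poly_op n ?p T (Q u)) \<le> sqrt (max C 0 + t\<^sup>2) * norm u" .
      then have "norm (poly_op n ?p T (Q u)) * norm u \<le> sqrt (max C 0 + t\<^sup>2) * (norm u)\<^sup>2"
        using mult_right_mono[of _ _ "norm u"] by (fastforce simp: power2_eq_square mult.assoc)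
      moreover have "w + \<i> * complex_of_real t * complex_of_real ((norm u)\<^sup>2)
          = cinner (poly_op n ?p T (Q u)) u"
        by (simp add: w_def poly_op_quad[OF i T] Q(3)[OF u] cinner_linear cinner_self)
      ultimately show ?thesis using cauchy_schwarz[of "poly_op n ?p T (Q u)" u] by simp
    qed
    then have "Im w = 0" by (rule Im_eq_0_if_shifts_bounded[rotated]) auto
    then show ?thesis by (simp add: w_def cinner_linear)
  qed
  \<comment> \<open>The quadratic form of \<open>D\<close> vanishes by the cases \<open>a = 1\<close> and \<open>a = \<i>\<close>.\<close>
  define D where "D x = T (n - i) (Q x) - adjoint_on UNIV (T i) x" for x
  note linQ = adjoint_pair_linear[OF adjoint_pair_sym[OF Q(1)]]
    and lina = adjoint_pair_linear[OF adjoint_pair_sym[OF adj]]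
  have "D u = 0"
  proof (rule zero_if_quadratic_form_zero[OF M _ _ _ _ u])
    show "D x \<in> M" if "x \<in> M" for x unfolding D_def by (intro csubspace_diff M inv Q that)
    show "D (x + y) = D x + D y" for x y by (simp add: D_def linQ lina op_add[OF bni])
    show "D (c *\<^sub>C x) = c *\<^sub>C D x" for c x
      by (simp add: D_def linQ lina op_scaleC[OF bni] scaleC_diff_right)
    fix x assume x: "x \<in> M"
    have "cinner (T (n - i) (Q x)) x = cnj (cinner (T i x) x)"
      using real[of 1, OF _ x] real[of \<i>, OF _ x] by (simp add: complex_eq_iff)
    also have "\<dots> = cinner (adjoint_on UNIV (T i) x) x"
      by (metis adj adjoint_pairD cinner_commute)
    finally show "cinner (D x) x = 0" by (simp add: D_def cinner_diff_left)
  qed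
  then show ?thesis by (simp add: D_def)
qed

text \<open>If \<open>Q\<close> inverts \<open>P\<close>, then \<open>P x - c x = y\<close> is the fixed point equation \<open>x = Q (y + c x)\<close>, whose
  right-hand side is a strict contraction for \<open>\<bar>c\<bar> < 1\<close>.\<close>

lemma unitary_shift_inverse:
  assumes M: "closed_csubspace M" and lin: "\<And>x y. Q (x - y) = Q x - Q y"
    and Q: "\<And>x. x \<in> M \<Longrightarrow> Q x \<in> M" "\<And>x. norm (Q x) \<le> norm x"
    and P: "\<And>x. x \<in> M \<Longrightarrow> P x \<in> M" "\<And>x. x \<in> M \<Longrightarrow> P (Q x) = x" "\<And>x. x \<in> M \<Longrightarrow> Q (P x) = x"
    and c: "cmod c < 1"
  obtains B where "\<And>y. y \<in> M \<Longrightarrow> B y \<in> M" "\<And>y. y \<in> M \<Longrightarrow> P (B y) - c *\<^sub>C B y = y"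
    "\<And>y. y \<in> M \<Longrightarrow> B (P y - c *\<^sub>C y) = y"
proof -
  have ex1: "\<exists>!x. x \<in> M \<and> P x - c *\<^sub>C x = y" if y: "y \<in> M" for y
  proof -
    define f where "f x = Q (y + c *\<^sub>C x)" for x
    have "\<exists>!x. x \<in> M \<and> f x = x"
    proof (rule Banach_fix[of M "cmod c" f])
      show "complete M" using csubspace_closed[OF M] by (simp add: complete_eq_closed)
      show "M \<noteq> {}" using csubspace_zero[OF M] by blast
      show "f ` M \<subseteq> M" unfolding f_def by (intro image_subsetI Q csubspace_add csubspace_scaleC M y)
      show "dist (f x) (f z) \<le> cmod c * dist x z" for x z
      proof -
        have "f x - f z = Q (c *\<^sub>C (x - z))" by (simp add: f_def scaleC_diff_right flip: lin)
        then show ?thesis using Q(2)[of "c *\<^sub>C (x - z)"] by (simp add: dist_norm norm_scaleC)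
      qed
    qed (use c in auto)
    moreover have "f x = x \<longleftrightarrow> P x - c *\<^sub>C x = y" if x: "x \<in> M" for x
    proof -
      have "y + c *\<^sub>C x \<in> M" by (intro csubspace_add csubspace_scaleC M x y)
      then have "f x = x \<longleftrightarrow> P x = y + c *\<^sub>C x" using P x unfolding f_def by metis
      then show ?thesis by (auto simp: algebra_simps)
    qed
    ultimately show ?thesis by metis
  qed
  define B where "B y = (THE x. x \<in> M \<and> P x - c *\<^sub>C x = y)" for y
  have B: "B y \<in> M \<and> P (B y) - c *\<^sub>C B y = y" if "y \<in> M" for y
    unfolding B_def by (rule theI'[OF ex1[OF that]])
  have "B (P y - c *\<^sub>C y) = y" if y: "y \<in> M" for y
  proof -
    have "P y - c *\<^sub>C y \<in> M" by (intro csubspace_diff csubspace_scaleC M P y)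
    then show ?thesis using B ex1 y by metis
  qed
  then show thesis using B by (intro that[of B]) auto
qed

text \<open>Each \<open>T\<^sub>i\<close> with \<open>i < n\<close> is normal because its adjoint is \<open>T\<^sub>n\<^sub>-\<^sub>i Q\<close>, a product of operators
  commuting with \<open>T\<^sub>i\<close>. A point of the spectrum lies in the symmetrized polydisc, and its last
  coordinate is unimodular: at a point with smaller last coordinate \<open>T\<^sub>n - \<mu>\<^sub>n\<close> is invertible, so that
  the Koszul complex is exact.\<close>

theorem gamma_unitary_on_unitary_part:
  assumes n: "n \<ge> 1" and G: "gamma_contraction_on UNIV n T" and M: "closed_csubspace M"
    and red: "\<And>i. i \<in> {1..n} \<Longrightarrow> reduces M (T i)"
    and Q: "adjoint_pair (T n) Q" "\<And>x. norm (Q x) \<le> norm x"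
    and PQ: "\<And>x. x \<in> M \<Longrightarrow> T n (Q x) = x" and QP: "\<And>x. x \<in> M \<Longrightarrow> Q (T n x) = x"
  shows "gamma_unitary_on M n T"
proof -
  have K: "spectral_set_on UNIV n (sym_polydisc n) T" using G by (simp add: gamma_contraction_on_def)
  then have T: "commuting_tuple_on UNIV n T" by (simp add: spectral_set_on_def)
  have nn: "n \<in> {1..n}" using n by simp
  have GM: "gamma_contraction_on M n T" by (rule gamma_contraction_on_reducing[OF G M red])
  then have TM: "commuting_tuple_on M n T" and spec: "taylor_spectrum M n T \<subseteq> sym_polydisc n"
    by (auto simp: gamma_contraction_on_def spectral_set_on_def)
  have Q_eq: "Q x = adjoint_on UNIV (T n) x" for x
    by (rule adjoint_on_eqI[symmetric, OF closed_csubspace_UNIV]) (auto simp: adjoint_pairD[OF Q(1)])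
  have QM: "Q x \<in> M" if "x \<in> M" for x unfolding Q_eq by (rule reducesD(2)[OF red[OF nn] that])
  have normal: "normal_op_on M (T i)" if i: "i \<in> {1..n}" for i
  proof -
    define A where "A = adjoint_on UNIV (T i)"
    have AM: "A x \<in> M" if "x \<in> M" for x unfolding A_def by (rule reducesD(2)[OF red[OF i] that])
    have adj: "adjoint_on M (T i) x = A x" if "x \<in> M" for x
      by (rule adjoint_on_eqI[OF M AM[OF that]])
        (simp add: A_def adjoint_pairD[OF adjoint_pair_adjoint[OF tuple_bounded[OF T i]]])
    have "T i (A x) = A (T i x)" if x: "x \<in> M" for x
    proof (cases "i = n")
      case True
      then have "A x = Q x" for x by (simp add: A_def Q_eq)
      then show ?thesis using True PQ[OF x] QP[OF x] by simp
    next
      case False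
      then have i': "i \<in> {1..n - 1}" "n - i \<in> {1..n}" using i by auto
      have A: "A y = T (n - i) (Q y)" if "y \<in> M" for y
        unfolding A_def
        by (rule adjoint_eq_on_unitary_part[OF G i'(1) M reducesD(2)[OF red[OF i]]
              reducesD(1)[OF red[OF i'(2)]] Q(1) QM PQ Q(2) that])
      have iM: "T i y \<in> M" if "y \<in> M" for y by (rule reducesD(1)[OF red[OF i] that])
      have "Q (T i x) = Q (T i (T n (Q x)))" by (simp add: PQ[OF x])
      also have "\<dots> = Q (T n (T i (Q x)))" by (simp add: tuple_commute[OF T i nn])
      also have "\<dots> = T i (Q x)" by (rule QP[OF iM[OF QM[OF x]]])
      finally show ?thesis
        by (simp add: A[OF x] A[OF iM[OF x]] tuple_commute[OF T i i'(2)])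
    qed
    moreover have "bounded_op_on M (T i)" using TM i by (simp add: commuting_tuple_on_def)
    ultimately show ?thesis
      by (simp add: normal_op_on_def adj reducesD(1)[OF red[OF i]])
  qed
  have "taylor_spectrum M n T \<subseteq> sym_torus n"
  proof
    fix \<mu> assume \<mu>: "\<mu> \<in> taylor_spectrum M n T"
    have "\<not> cmod (\<mu> n) < 1"
    proof
      assume c: "cmod (\<mu> n) < 1"
      obtain B where B: "\<And>y. y \<in> M \<Longrightarrow> B y \<in> M" "\<And>y. y \<in> M \<Longrightarrow> T n (B y) - \<mu> n *\<^sub>C B y = y"
        "\<And>y. y \<in> M \<Longrightarrow> B (T n y - \<mu> n *\<^sub>C y) = y"
        using unitary_shift_inverse[OF M adjoint_pair_linear(3)[OF adjoint_pair_sym[OF Q(1)]] QM Q(2)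
            reducesD(1)[OF red[OF nn]] PQ QP c] by blast
      have "koszul_exact M n (\<lambda>i x. T i x - \<mu> i *\<^sub>C x)"
      proof (rule koszul_exact_if_last_invertible[where B = B, OF n M])
        show "T i x - \<mu> i *\<^sub>C x \<in> M" if "i \<in> {1..n}" "x \<in> M" for i x
          using that by (intro csubspace_diff csubspace_scaleC M reducesD(1)[OF red])
      qed (use B in \<open>auto intro: bounded_op_shift[OF T] shift_commute[OF T]\<close>)
      then show False using \<mu> by (simp add: taylor_spectrum_def)
    qed
    then show "\<mu> \<in> sym_torus n" using \<mu> spec by (intro in_sym_torus[OF n]) auto
  qed
  then show ?thesis using TM normal by (simp add: gamma_unitary_on_def)
qed

section \<open>The decomposition\<close>

theorem theorem4p15:
  fixes n :: nat
    and S :: "nat \<Rightarrow> 'a \<Rightarrow> 'a::complex_hilbert_space"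
    and P :: "'a \<Rightarrow> 'a"
    and E :: "'a set"
  assumes "n \<ge> 2"
    and "gamma_contraction_on UNIV n (S(n := P))"
    and "E = {x. \<forall>y. (\<lambda>k. cinner ((P ^^ k) x) y) \<longlonglongrightarrow> 0}"
  shows "(\<forall>i\<in>{1..n - 1}. reduces E (S i) \<and> reduces (orth_complement E) (S i)) \<and>
         weakly_stable_gamma_contraction_on E n (S(n := P)) \<and>
         gamma_unitary_on (orth_complement E) n (S(n := P))"
proof -
  define T where "T = S(n := P)"
  define Q where "Q = adjoint_on UNIV P"
  have n: "n \<ge> 1" "n \<in> {1..n}" using assms(1) by auto
  have Tn: "T n = P" by (simp add: T_def)
  have G: "gamma_contraction_on UNIV n T" using assms(2) by (simp add: T_def)
  then have K: "spectral_set_on UNIV n (sym_polydisc n) T" by (simp add: gamma_contraction_on_def)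
  then have T: "commuting_tuple_on UNIV n T" by (simp add: spectral_set_on_def)
  have E: "E = weak_null_set P" using assms(3) by (simp add: weak_null_set_def)
  have PQ: "adjoint_pair P Q"
    unfolding Q_def using adjoint_pair_adjoint[OF tuple_bounded[OF T n(2)]] by (simp add: Tn)
  note QP = adjoint_pair_sym[OF PQ]
  have P: "norm (P x) \<le> norm x" for x
    using spectral_set_poly_bound[OF K var_in[OF n(2)], of 1 x]
    by (simp add: poly_at_var[OF n(2)] poly_op_var[OF n(2)] norm_last_le_1[OF n(1)] Tn)
  have Q: "norm (Q x) \<le> norm x" for x by (rule adjoint_contraction[OF PQ P])
  have EQ: "weak_null_set P = weak_null_set Q" by (rule weak_null_set_adjoint[OF PQ P])
  have EM: "closed_csubspace E" unfolding E by (rule closed_csubspace_weak_null_set[OF PQ P])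
  have red: "reduces E (T i)" if i: "i \<in> {1..n}" for i
  proof -
    let ?A = "adjoint_on UNIV (T i)"
    have adj: "adjoint_pair (T i) ?A" by (rule adjoint_pair_adjoint[OF tuple_bounded[OF T i]])
    have comm: "P (T i x) = T i (P x)" for x using tuple_commute[OF T n(2) i] by (simp add: Tn)
    have "T i x \<in> E" if "x \<in> E" for x
      using weak_null_set_invariant[of _ _ P, OF adj comm] that by (simp add: E)
    moreover have "?A x \<in> E" if "x \<in> E" for x
      using weak_null_set_invariant[of _ _ Q, OF adjoint_pair_sym[OF adj] adjoint_pair_commute[OF PQ adj comm]] that
      by (simp add: E EQ)
    ultimately show ?thesis using EM by (auto simp: reduces_def)
  qed
  have red': "reduces (orth_complement E) (T i)" if "i \<in> {1..n}" for i
    by (rule reduces_orth_complement[OF tuple_bounded[OF T that] red[OF that]])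
  have "gamma_contraction_on E n T" by (rule gamma_contraction_on_reducing[OF G EM red])
  then have "weakly_stable_gamma_contraction_on E n T"
    by (simp add: weakly_stable_gamma_contraction_on_def Tn E weak_null_set_def)
  moreover have "gamma_unitary_on (orth_complement E) n T"
  proof (rule gamma_unitary_on_unitary_part[OF n(1) G closed_csubspace_orth_complement red'])
    show "adjoint_pair (T n) Q" by (simp add: Tn PQ)
    show "T n (Q x) = x" if "x \<in> orth_complement E" for x
      using isometric_off_weak_null_set[OF QP Q] that by (simp add: Tn E EQ)
    show "Q (T n x) = x" if "x \<in> orth_complement E" for x
      using isometric_off_weak_null_set[OF PQ P] that by (simp add: Tn E)
  qed (use Q in auto)
  moreover have "reduces E (S i) \<and> reduces (orth_complement E) (S i)" if "i \<in> {1..n - 1}" for i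
  proof -
    have "i \<in> {1..n}" "T i = S i" using that n(1) by (auto simp: T_def)
    then show ?thesis using red[of i] red'[of i] by simp
  qed
  ultimately show ?thesis by (simp add: T_def)
qed

end
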